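(* For any integer $n\ge 4$, the prism graph $C_n\square P_2$ is $\mathbb{Z}_4$-flow-connected.
   Context: $C_n\square P_2$ is the Cartesian product of the cycle on $n$ vertices with the path on $2$ vertices: its vertices are $v_1,\dots,v_n,w_1,\dots,w_n$ and its edges are $v_iv_{i+1}$, $w_iw_{i+1}$ and $v_iw_i$ for all $i$ (indices modulo $n$). A cycle is a connected 2-regular graph. Fix an arbitrary orientation $D$ of a graph $G$; for a vertex $v$ let $E_D^+(v)$ and $E_D^-(v)$ be the sets of edges directed out of and into $v$. For an abelian group $A$, an $A$-flow on $G$ (always nowhere-zero here) is a function $f:E(G)\to A\setminus\{0_A\}$ with $\sum_{e\in E_D^+(v)}f(e)-\sum_{e\in E_D^-(v)}f(e)=0_A$ for every vertex $v$. (Flows given with different orientations are identified by negating the value of every edge whose orientation is reversed, so the choice of $D$ does not matter.) Two $A$-flows $f',f''$ are adjacent if there is a cycle $C$ in $G$ such that $f'(e)=f''(e)$ for all $e\notin E(C)$, and equivalent if they are joined by a finite sequence of $A$-flows in which consecutive flows are adjacent. $G$ is $A$-flow-connected if all its $A$-flows are pairwise equivalent. *)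

theory Defs
  imports Main "HOL-Library.FuncSet" "HOL-Library.Numeral_Type"
begin

record 'a graph =
  verts :: "'a set"
  edges :: "'a set set"

definition simple_graph :: "'a graph \<Rightarrow> bool" where
  "simple_graph G \<longleftrightarrow> finite (verts G) \<and> (\<forall>e\<in>edges G. e \<subseteq> verts G \<and> card e = 2)"

definition subgraph :: "'a graph \<Rightarrow> 'a graph \<Rightarrow> bool" where
  "subgraph H G \<longleftrightarrow> simple_graph H \<and> verts H \<subseteq> verts G \<and> edges H \<subseteq> edges G"

definition degree :: "'a graph \<Rightarrow> 'a \<Rightarrow> nat" where
  "degree G v = card {e \<in> edges G. v \<in> e}"

definition regular :: "nat \<Rightarrow> 'a graph \<Rightarrow> bool" where
  "regular k G \<longleftrightarrow> (\<forall>v\<in>verts G. degree G v = k)"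

definition connected_graph :: "'a graph \<Rightarrow> bool" where
  "connected_graph G \<longleftrightarrow>
     verts G \<noteq> {} \<and> (\<forall>u\<in>verts G. \<forall>v\<in>verts G. (u, v) \<in> {(x, y). {x, y} \<in> edges G}\<^sup>*)"

definition is_cycle :: "'a graph \<Rightarrow> bool" where
  "is_cycle C \<longleftrightarrow> simple_graph C \<and> connected_graph C \<and> regular 2 C"

text \<open>An orientation is the set of its arcs \<open>(tail, head)\<close>. On a loop the condition would be
  unsatisfiable; simple graphs always have an orientation (lemma \<open>orientation_exists\<close>).\<close>

definition orientation :: "'a graph \<Rightarrow> ('a \<times> 'a) set \<Rightarrow> bool" where
  "orientation G D \<longleftrightarrow>
     D \<subseteq> {(u, v). {u, v} \<in> edges G} \<and>
     (\<forall>u v. {u, v} \<in> edges G \<longrightarrow> (u, v) \<in> D \<longleftrightarrow> (v, u) \<notin> D)"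

definition out_edges :: "('a \<times> 'a) set \<Rightarrow> 'a \<Rightarrow> 'a set set" where
  "out_edges D v = {{v, u} |u. (v, u) \<in> D}"

definition in_edges :: "('a \<times> 'a) set \<Rightarrow> 'a \<Rightarrow> 'a set set" where
  "in_edges D v = {{u, v} |u. (u, v) \<in> D}"

text \<open>Flows are functions on the edge set only, hence the extensional function space: distinct
  flows differ on some edge of the graph.\<close>

definition flow :: "'a graph \<Rightarrow> ('a \<times> 'a) set \<Rightarrow> ('a set \<Rightarrow> 'b::ab_group_add) \<Rightarrow> bool" where
  "flow G D f \<longleftrightarrow>
     f \<in> edges G \<rightarrow>\<^sub>E (UNIV - {0}) \<and>
     (\<forall>v\<in>verts G. (\<Sum>e\<in>out_edges D v. f e) - (\<Sum>e\<in>in_edges D v. f e) = 0)"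

definition flow_adjacent ::
    "'a graph \<Rightarrow> ('a \<times> 'a) set \<Rightarrow> ('a set \<Rightarrow> 'b::ab_group_add) \<Rightarrow> ('a set \<Rightarrow> 'b) \<Rightarrow> bool" where
  "flow_adjacent G D f g \<longleftrightarrow>
     flow G D f \<and> flow G D g \<and>
     (\<exists>C. is_cycle C \<and> subgraph C G \<and> (\<forall>e\<in>edges G - edges C. f e = g e))"

definition flow_equivalent ::
    "'a graph \<Rightarrow> ('a \<times> 'a) set \<Rightarrow> ('a set \<Rightarrow> 'b::ab_group_add) \<Rightarrow> ('a set \<Rightarrow> 'b) \<Rightarrow> bool" where
  "flow_equivalent G D = (flow_adjacent G D)\<^sup>*\<^sup>*"

text \<open>The abelian group is passed as a type; the integers modulo 4 are the numeral type
  \<open>4\<close>, whose arithmetic is modular. The choice of orientation is immaterial, so the property is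
  required for all of them.\<close>

definition flow_connected :: "'b::ab_group_add itself \<Rightarrow> 'a graph \<Rightarrow> bool" where
  "flow_connected A G \<longleftrightarrow>
     (\<forall>D. orientation G D \<longrightarrow>
       (\<forall>f g :: 'a set \<Rightarrow> 'b. flow G D f \<longrightarrow> flow G D g \<longrightarrow> flow_equivalent G D f g))"

text \<open>The cycle on \<open>n\<close> vertices, meaningful for \<open>n \<ge> 3\<close>.\<close>

definition cycle_graph :: "nat \<Rightarrow> nat graph" where
  "cycle_graph n = \<lparr>verts = {..<n}, edges = {{i, (i + 1) mod n} |i. i < n}\<rparr>"

definition path_graph :: "nat \<Rightarrow> nat graph" where
  "path_graph n = \<lparr>verts = {..<n}, edges = {{i, i + 1} |i. i + 1 < n}\<rparr>"

definition cartesian_product :: "'a graph \<Rightarrow> 'b graph \<Rightarrow> ('a \<times> 'b) graph" (infixl "\<box>" 70) where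
  "G \<box> H = \<lparr>verts = verts G \<times> verts H,
            edges = {{(u, x), (v, x)} |u v x. {u, v} \<in> edges G \<and> x \<in> verts H} \<union>
                    {{(u, x), (u, y)} |u x y. u \<in> verts G \<and> {x, y} \<in> edges H}\<rparr>"

text \<open>In the prism, \<open>(i, 0)\<close> and \<open>(i, 1)\<close> play the roles of \<open>v\<^sub>i\<close> and \<open>w\<^sub>i\<close>, with indices
  running from \<open>0\<close> to \<open>n - 1\<close>.\<close>

abbreviation prism :: "nat \<Rightarrow> (nat \<times> nat) graph" where
  "prism n \<equiv> cycle_graph n \<box> path_graph 2"

lemma orientation_exists:
  assumes "simple_graph G"
  shows "\<exists>D. orientation G D"
proof -
  define t where "t e = (SOME x. x \<in> e)" for e :: "'a set"
  let ?D = "{(u, v). {u, v} \<in> edges G \<and> u = t {u, v}}"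
  have "(u, v) \<in> ?D \<longleftrightarrow> (v, u) \<notin> ?D" if e: "{u, v} \<in> edges G" for u v
  proof -
    have "card {u, v} = 2" using assms e by (auto simp: simple_graph_def)
    then have "u \<noteq> v" by auto
    moreover have "t {u, v} \<in> {u, v}" unfolding t_def by (rule someI_ex) auto
    ultimately show ?thesis using e by (auto simp: insert_commute)
  qed
  then have "orientation G ?D" by (auto simp: orientation_def)
  then show ?thesis ..
qed

lemma prism_verts: "verts (prism n) = (\<lambda>i. (i, 0)) ` {..<n} \<union> (\<lambda>i. (i, 1)) ` {..<n}"
  by (auto simp: cartesian_product_def cycle_graph_def path_graph_def less_2_cases_iff)

lemma prism_edges:
  "edges (prism n) =
     {{(i, 0), ((i + 1) mod n, 0)} |i. i < n} \<union>
     {{(i, 1), ((i + 1) mod n, 1)} |i. i < n} \<union>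
     {{(i, 0), (i, 1)} |i. i < n}" (is "_ = ?R")
proof
  have p: "{x, y} \<in> edges (path_graph 2) \<longleftrightarrow> x = 0 \<and> y = 1 \<or> x = 1 \<and> y = 0" for x y
    by (auto simp: path_graph_def doubleton_eq_iff)
  show "edges (prism n) \<subseteq> ?R"
  proof
    fix e assume "e \<in> edges (prism n)"
    then consider u v x where "e = {(u, x), (v, x)}" "{u, v} \<in> edges (cycle_graph n)" "x < 2"
      | u x y where "e = {(u, x), (u, y)}" "u < n" "{x, y} \<in> edges (path_graph 2)"
      by (auto simp: cartesian_product_def cycle_graph_def path_graph_def)
    then show "e \<in> ?R"
    proof cases
      case 1
      then obtain i where "{u, v} = {i, (i + 1) mod n}" "i < n"
        by (auto simp: cycle_graph_def)
      then show ?thesis using 1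
        by (auto simp: doubleton_eq_iff less_2_cases_iff insert_commute)
    next
      case 2
      then show ?thesis by (auto simp: p insert_commute)
    qed
  qed
  show "?R \<subseteq> edges (prism n)"
  proof
    fix e assume "e \<in> ?R"
    then obtain i where i: "i < n"
      and "e = {(i, 0), ((i + 1) mod n, 0)} \<or> e = {(i, 1), ((i + 1) mod n, 1)} \<or> e = {(i, 0), (i, 1)}"
      by blast
    moreover have "{i, (i + 1) mod n} \<in> edges (cycle_graph n)" "i \<in> verts (cycle_graph n)"
      using i by (auto simp: cycle_graph_def)
    moreover have "{0, 1} \<in> edges (path_graph 2)" "0 \<in> verts (path_graph 2)" "1 \<in> verts (path_graph 2)"
      by (auto simp: p) (auto simp: path_graph_def)
    ultimately show "e \<in> edges (prism n)"
      unfolding cartesian_product_def graph.simps by blast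
  qed
qed

lemma simple_graph_prism:
  assumes "n \<ge> 3"
  shows "simple_graph (prism n)"
proof -
  have m: "(i + 1) mod n < n \<and> (i + 1) mod n \<noteq> i" if "i < n" for i
    using assms that by (auto simp: mod_Suc)
  have "e \<subseteq> verts (prism n) \<and> card e = 2" if "e \<in> edges (prism n)" for e
  proof -
    from that obtain i where i: "i < n"
      and "e = {(i, 0), ((i + 1) mod n, 0)} \<or> e = {(i, 1), ((i + 1) mod n, 1)} \<or> e = {(i, 0), (i, 1)}"
      unfolding prism_edges by blast
    then show ?thesis using m[OF i] unfolding prism_verts by (elim disjE) auto
  qed
  moreover have "finite (verts (prism n))" by (simp add: prism_verts)
  ultimately show ?thesis by (simp add: simple_graph_def)
qed

end

theory Submission
  imports Defs
begin

text \<open>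
Let \<open>a\<^sub>k\<close> and \<open>b\<^sub>k\<close> be the values of a \<open>\<int>\<^sub>4\<close>-flow on the edges from vertex \<open>k\<close> to vertex \<open>k + 1\<close> of the
outer and the inner rim. By conservation the rung at \<open>k\<close> carries \<open>a\<^bsub>k-1\<^esub> - a\<^sub>k = b\<^sub>k - b\<^bsub>k-1\<^esub>\<close>
(\<open>prism_flow_iff\<close>). So \<open>a\<^sub>k + b\<^sub>k\<close> does not depend on \<open>k\<close>, and \<open>a\<close> is a proper colouring of the cycle by the
nonzero elements \<open>1\<close>, \<open>2\<close>, \<open>3\<close>. Changing the flow along the inner rim alone makes \<open>b = - a\<close>
(\<open>flow_equivalent_coloring_flow\<close>), after which flows are the same as 3-colourings of the cycle.

Adding a constant to the colours of a segment that is not the whole cycle, when it leaves the colouring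
proper, is a change of the flow along a rectangle (\<open>flow_adjacent_along_rectangle\<close>). Two
instances suffice: recolouring one vertex, and exchanging \<open>1\<close> and \<open>3\<close>, by adding \<open>2\<close>, on a segment that is
enclosed by vertices of colour \<open>2\<close> and contains none. A vertex of colour \<open>2\<close> with equally coloured
neighbours can be recoloured; if the neighbours differ but another \<open>2\<close> exists, an exchange on one side
makes them equal. This removes the colour \<open>2\<close> up to at most one occurrence (\<open>reduce_twos\<close>), and the
remaining colours alternate between \<open>1\<close> and \<open>3\<close>. Hence parity decides how it ends.

If \<open>n\<close> is even, no \<open>2\<close> is left, and the two alternating colourings are exchanged by shifting first
one rim and then the other by \<open>2\<close> (\<open>flow_equivalent_swapped\<close>). If \<open>n\<close> is odd, exactly one \<open>2\<close> is left. For
\<open>n \<ge> 5\<close> it can be moved by two positions (\<open>move_only_two\<close>), hence to position \<open>0\<close>, and the rest can be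
exchanged, so all colourings reach the same one (\<open>normalize_only_two\<close>).
\<close>

section \<open>Colouring a cycle with three colours\<close>

lemma Z4_exhaust: "x = 0 \<or> x = 1 \<or> x = 2 \<or> x = (3::4)"
proof (cases x)
  case (of_int z)
  then have "z = 0 \<or> z = 1 \<or> z = 2 \<or> z = 3" by auto
  with of_int show ?thesis by auto
qed

lemma Z4_alternate:
  fixes x y :: 4
  assumes "x \<noteq> 0" "y \<noteq> 0" "x \<noteq> 2" "y \<noteq> 2" "x \<noteq> y"
  shows "y = x + 2"
  using assms Z4_exhaust[of x] Z4_exhaust[of y] by auto

lemma Z4_add_two_eq_0_iff: "x + 2 = 0 \<longleftrightarrow> x = (2::4)"
  using Z4_exhaust[of x] by auto

text \<open>The vertices of the cycle are the integers modulo \<open>n\<close>, so a colouring is a periodic function on all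
integers; a segment may then pass the position \<open>0\<close> without a case distinction.\<close>
definition coloring :: "nat \<Rightarrow> (int \<Rightarrow> 4) \<Rightarrow> bool" where
  "coloring n a \<longleftrightarrow> (\<forall>k. a (k + int n) = a k) \<and> (\<forall>k. a k \<noteq> 0) \<and> (\<forall>k. a k \<noteq> a (k + 1))"

definition shift_segment :: "nat \<Rightarrow> int \<Rightarrow> nat \<Rightarrow> 4 \<Rightarrow> (int \<Rightarrow> 4) \<Rightarrow> int \<Rightarrow> 4" where
  "shift_segment n i L x a = (\<lambda>k. if (k - i) mod int n < int L then a k + x else a k)"

text \<open>Adding a constant on a proper segment is what changing a flow along a rectangle of the prism does to
its colouring. The bound \<open>L < n\<close> keeps the two rungs that end the rectangle apart.\<close>
definition coloring_step :: "nat \<Rightarrow> (int \<Rightarrow> 4) \<Rightarrow> (int \<Rightarrow> 4) \<Rightarrow> bool" where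
  "coloring_step n a b \<longleftrightarrow> coloring n a \<and> coloring n b \<and>
     (\<exists>i L x. 0 < L \<and> L < n \<and> b = shift_segment n i L x a)"

lemma periodic_cong:
  fixes a :: "int \<Rightarrow> 'c"
  assumes per: "\<And>k. a (k + int n) = a k" and "k mod int n = l mod int n"
  shows "a k = a l"
proof -
  have *: "a (k + int m * int n) = a k" for k m
  proof (induction m)
    case (Suc m)
    have "k + int (Suc m) * int n = (k + int m * int n) + int n" by (simp add: algebra_simps)
    then show ?case using Suc per by metis
  qed simp
  obtain q where q: "k - l = int n * q"
    using assms(2) by (auto simp: mod_eq_dvd_iff)
  show ?thesis
  proof (cases "0 \<le> q")
    case True
    then have "k = l + int (nat q) * int n" using q by (simp add: algebra_simps)
    then show ?thesis using * by metis
  next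
    case False
    then have "l = k + int (nat (- q)) * int n" using q by (simp add: algebra_simps)
    then show ?thesis using * by metis
  qed
qed

lemma coloring_cong: "coloring n a \<Longrightarrow> k mod int n = l mod int n \<Longrightarrow> a k = a l"
  by (rule periodic_cong) (auto simp: coloring_def)

lemma succ_mod:
  fixes k :: int
  assumes "0 < n"
  shows "(k + 1 - i) mod int n = (if (k - i) mod int n = int n - 1 then 0 else (k - i) mod int n + 1)"
proof -
  have "(k + 1 - i) mod int n = ((k - i) mod int n + 1) mod int n"
    by (simp add: mod_simps algebra_simps)
  moreover have "0 \<le> (k - i) mod int n" "(k - i) mod int n < int n" using assms by simp_all
  ultimately show ?thesis by (auto simp: mod_pos_pos_trivial)
qed

text \<open>The segment here is the single vertex \<open>p\<close>, and any new colour is reached by adding a constant.\<close>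
lemma coloring_recolor:
  assumes a: "coloring n a" and n: "2 \<le> n"
    and y: "y \<noteq> 0" "y \<noteq> a (p - 1)" "y \<noteq> a (p + 1)"
  shows "coloring_step n a (\<lambda>k. if int n dvd k - p then y else a k)" (is "coloring_step n a ?b")
proof -
  have b_cong: "?b = shift_segment n p 1 (y - a p) a"
  proof
    fix k
    have "0 \<le> (k - p) mod int n" using n by simp
    then have "(k - p) mod int n < int 1 \<longleftrightarrow> int n dvd k - p"
      unfolding dvd_eq_mod_eq_0 by linarith
    moreover have "a k = a p" if "int n dvd k - p"
      using that by (intro coloring_cong[OF a]) (simp add: mod_eq_dvd_iff)
    ultimately show "?b k = shift_segment n p 1 (y - a p) a k" by (auto simp: shift_segment_def)
  qed
  have per: "?b (k + int n) = ?b k" for k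
  proof -
    have "k + int n - p = (k - p) + int n" by simp
    then have "int n dvd k + int n - p \<longleftrightarrow> int n dvd k - p" by (metis dvd_add_left_iff dvd_refl)
    moreover have "a (k + int n) = a k" using a by (simp add: coloring_def)
    ultimately show ?thesis by simp
  qed
  have "?b k \<noteq> ?b (k + 1)" for k
  proof (cases "int n dvd k - p \<or> int n dvd k + 1 - p")
    case False
    then show ?thesis using a by (auto simp: coloring_def)
  next
    case True
    have "\<not> (int n dvd k - p \<and> int n dvd k + 1 - p)"
    proof
      assume "int n dvd k - p \<and> int n dvd k + 1 - p"
      then have "int n dvd (k + 1 - p) - (k - p)" using dvd_diff by blast
      then show False using n by simp
    qed
    moreover have "a (k + 1) = a (p + 1)" if "int n dvd k - p"
      using that by (intro coloring_cong[OF a]) (simp add: mod_eq_dvd_iff)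
    moreover have "a k = a (p - 1)" if "int n dvd k + 1 - p"
      using that by (intro coloring_cong[OF a]) (simp add: mod_eq_dvd_iff algebra_simps)
    ultimately show ?thesis using True y by auto
  qed
  then have "coloring n ?b" using per y(1) a by (auto simp: coloring_def)
  moreover have "0 < (1::nat)" "1 < n" using n by simp_all
  ultimately show ?thesis unfolding coloring_step_def using a b_cong by blast
qed

text \<open>Adding \<open>2\<close> exchanges the colours \<open>1\<close> and \<open>3\<close>. It keeps the colouring proper because the segment contains
no \<open>2\<close> and is enclosed by vertices of colour \<open>2\<close>, which are one and the same vertex if \<open>L = n - 1\<close>.\<close>
lemma coloring_swap_segment:
  assumes a: "coloring n a" and L: "0 < L" "L < n"
    and ends: "a (i - 1) = 2" "a (i + int L) = 2"
    and seg: "\<And>j. j < L \<Longrightarrow> a (i + int j) \<noteq> 2"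
  shows "coloring_step n a (shift_segment n i L 2 a)" (is "coloring_step n a ?b")
proof -
  have nz: "a k \<noteq> 0" for k using a by (simp add: coloring_def)
  have two: "a k + 2 \<noteq> 2" for k using nz[of k] by simp
  have pos: "0 < int n" using L by simp
  have inside: "a k \<noteq> 2" if "(k - i) mod int n < int L" for k
  proof -
    have "a k = a (i + int (nat ((k - i) mod int n)))"
      using pos by (intro coloring_cong[OF a]) (simp add: mod_simps)
    moreover have "nat ((k - i) mod int n) < L" using that pos by (simp add: nat_less_iff)
    ultimately show ?thesis using seg by metis
  qed
  have per: "?b (k + int n) = ?b k" for k
  proof -
    have "k + int n - i = (k - i) + int n" by simp
    then have "(k + int n - i) mod int n = (k - i) mod int n" by (metis mod_add_self2)
    then show ?thesis using a by (simp add: shift_segment_def coloring_def)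
  qed
  have "?b k \<noteq> 0" for k
    using inside[of k] nz[of k] by (simp add: shift_segment_def Z4_add_two_eq_0_iff)
  moreover have "?b k \<noteq> ?b (k + 1)" for k
  proof -
    have neq: "a k \<noteq> a (k + 1)" using a by (simp add: coloring_def)
    let ?r = "(k - i) mod int n"
    consider "?r = int n - 1" | "?r \<noteq> int n - 1" "?r + 1 = int L" | "?r \<noteq> int n - 1" "?r + 1 \<noteq> int L"
      by blast
    then show ?thesis
    proof cases
      case 1
      have "a k = a (i - 1)"
      proof (intro coloring_cong[OF a])
        have "(k + 1 - i) mod int n = 0" using 1 L by (subst succ_mod) auto
        then have "int n dvd k + 1 - i" by (simp add: dvd_eq_mod_eq_0)
        then show "k mod int n = (i - 1) mod int n" by (simp add: mod_eq_dvd_iff algebra_simps)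
      qed
      then show ?thesis using 1 L ends two[of "k + 1"]
        by (auto simp: shift_segment_def succ_mod)
    next
      case 2
      have "(k + 1 - i) mod int n = int L" using 2 L by (subst succ_mod) auto
      then have "a (k + 1) = a (i + int L)"
        using L by (intro coloring_cong[OF a]) (metis add.commute diff_add_cancel mod_add_left_eq)
      then show ?thesis using 2 L ends two[of k]
        by (auto simp: shift_segment_def succ_mod)
    next
      case 3
      then show ?thesis using neq L by (auto simp: shift_segment_def succ_mod)
    qed
  qed
  ultimately have "coloring n ?b" using per unfolding coloring_def by blast
  then show ?thesis unfolding coloring_step_def using a L by blast
qed

text \<open>Where the colour \<open>2\<close> is absent only \<open>1\<close> and \<open>3\<close> remain, so the colour changes by \<open>2\<close> at each step.\<close>
lemma coloring_alternates:
  assumes a: "coloring n a" and "\<And>j. j \<le> m \<Longrightarrow> a (i + int j) \<noteq> 2"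
  shows "a (i + int m) = (if even m then a i else a i + 2)"
  using assms(2)
proof (induction m)
  case (Suc m)
  have "a (i + int (Suc m)) = a (i + int m) + 2"
  proof (rule Z4_alternate)
    have "a (i + int m) \<noteq> a (i + int m + 1)" using a by (simp add: coloring_def)
    then show "a (i + int m) \<noteq> a (i + int (Suc m))" by (simp add: algebra_simps)
    show "a (i + int m) \<noteq> 2" "a (i + int (Suc m)) \<noteq> 2" using Suc.prems[of m] Suc.prems[of "Suc m"] by auto
  qed (use a in \<open>auto simp: coloring_def\<close>)
  then show ?case using Suc by (auto simp: add.assoc)
qed simp

definition twos :: "nat \<Rightarrow> (int \<Rightarrow> 4) \<Rightarrow> int set" where
  "twos n a = {k \<in> {0..<int n}. a k = 2}"

lemma finite_twos: "finite (twos n a)"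
proof (rule finite_subset)
  show "twos n a \<subseteq> {0..<int n}" by (auto simp: twos_def)
qed simp

definition only_two_at :: "nat \<Rightarrow> int \<Rightarrow> (int \<Rightarrow> 4) \<Rightarrow> bool" where
  "only_two_at n p a \<longleftrightarrow> (\<forall>k. a k = 2 \<longleftrightarrow> int n dvd k - p)"

text \<open>If both neighbours of a \<open>2\<close> have the same colour, the third colour is free for it.\<close>
lemma remove_two:
  assumes a: "coloring n a" and n: "2 \<le> n" and p: "a p = 2" "a (p - 1) = a (p + 1)"
  shows "\<exists>b. coloring_step n a b \<and> card (twos n b) < card (twos n a)"
proof -
  \<comment> \<open>The colour of the neighbours is \<open>1\<close> or \<open>3\<close>; adding \<open>2\<close> gives the other of these.\<close>
  let ?b = "\<lambda>k. if int n dvd k - p then a (p + 1) + 2 else a k"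
  have p1: "a (p + 1) \<noteq> 2" "a (p + 1) \<noteq> 0" using a p(1) unfolding coloring_def by metis+
  then have y: "a (p + 1) + 2 \<noteq> 2" "a (p + 1) + 2 \<noteq> 0" by (auto simp: Z4_add_two_eq_0_iff)
  have "coloring_step n a ?b"
    using p y by (intro coloring_recolor[OF a n]) auto
  moreover have "card (twos n ?b) < card (twos n a)"
  proof (rule psubset_card_mono)
    show "finite (twos n a)" by (rule finite_twos)
    show "twos n ?b \<subset> twos n a"
    proof
      show "twos n ?b \<subseteq> twos n a" using y by (auto simp: twos_def split: if_splits)
      have "a (p mod int n) = 2" using p(1) coloring_cong[OF a, of "p mod int n" p] by simp
      then have "p mod int n \<in> twos n a" using n by (simp add: twos_def)
      moreover have "int n dvd p mod int n - p" by (simp add: mod_eq_dvd_iff [symmetric])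
      then have "p mod int n \<notin> twos n ?b" using y by (simp add: twos_def)
      ultimately show "twos n ?b \<noteq> twos n a" by blast
    qed
  qed
  ultimately show ?thesis by blast
qed

text \<open>Consider a \<open>2\<close> at \<open>p\<close> whose neighbours are coloured differently, that is, by \<open>1\<close> and \<open>3\<close>. If there is another
\<open>2\<close>, then the segment from \<open>p + 1\<close> up to the next \<open>2\<close> does not reach \<open>p - 1\<close>, and swapping \<open>1\<close> and \<open>3\<close> in it
makes the neighbours of \<open>p\<close> equal; now the \<open>2\<close> at \<open>p\<close> can be removed. This stops only when no \<open>2\<close> is left, or
a single one with different neighbours.\<close>
lemma reduce_twos:
  assumes n: "2 \<le> n" and "coloring n a"
  shows "\<exists>b. (coloring_step n)\<^sup>*\<^sup>* a b \<and> coloring n b \<and>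
    ((\<forall>k. b k \<noteq> 2) \<or> (\<exists>p. only_two_at n p b \<and> b (p - 1) \<noteq> b (p + 1)))"
  using assms(2)
proof (induction "card (twos n a)" arbitrary: a rule: less_induct)
  case less
  note a = \<open>coloring n a\<close>
  have nz: "a k \<noteq> 0" and per: "a (k + int n) = a k" for k using a by (auto simp: coloring_def)
  \<comment> \<open>Any reachable colouring with fewer twos finishes the proof, by induction.\<close>
  have progress: ?case if ab: "(coloring_step n)\<^sup>*\<^sup>* a b" and bc: "coloring_step n b c" and c: "card (twos n c) < card (twos n a)"
    for b c
  proof -
    have "coloring n c" using bc by (simp add: coloring_step_def)
    then obtain d where "(coloring_step n)\<^sup>*\<^sup>* c d" and d: "coloring n d"
      "(\<forall>k. d k \<noteq> 2) \<or> (\<exists>p. only_two_at n p d \<and> d (p - 1) \<noteq> d (p + 1))"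
      using less.hyps[OF c] by blast
    then have "(coloring_step n)\<^sup>*\<^sup>* a d" using ab bc by (meson rtranclp.rtrancl_into_rtrancl rtranclp_trans)
    then show ?thesis using d by blast
  qed
  show ?case
  proof (cases "\<exists>p. a p = 2")
    case False
    then show ?thesis using a by blast
  next
    case True
    then obtain p where p: "a p = 2" by blast
    have p1: "a (p + 1) \<noteq> 2" "a (p - 1) \<noteq> 2" using a p unfolding coloring_def by (metis, metis diff_add_cancel)
    \<comment> \<open>The next \<open>2\<close> after \<open>p\<close> is at \<open>p + 1 + L\<close>; it is the same vertex as \<open>p\<close> exactly when \<open>L = n - 1\<close>.\<close>
    define L where "L = (LEAST j. a (p + 1 + int j) = 2)"
    have "a (p + 1 + int (n - 1)) = 2" using per[of p] p n by (simp add: of_nat_diff)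
    then have L2: "a (p + 1 + int L) = 2" and "L \<le> n - 1"
      unfolding L_def by (rule LeastI, rule Least_le)
    have before: "a (p + 1 + int j) \<noteq> 2" if "j < L" for j
      using that unfolding L_def by (rule not_less_Least)
    have "0 < L" using L2 p1 by (cases L) auto
    show ?thesis
    proof (cases "a (p - 1) = a (p + 1)")
      case True
      then show ?thesis using remove_two[OF a n p] progress by blast
    next
      case neq: False
      show ?thesis
      proof (cases "L = n - 1")
        case True
        have "a k = 2 \<longleftrightarrow> int n dvd k - p" for k
        proof
          assume k: "a k = 2"
          let ?r = "(k - p) mod int n"
          have r: "0 \<le> ?r" "?r < int n" using n by simp_all
          have "a k = a (p + ?r)" by (intro coloring_cong[OF a]) (simp add: mod_simps)
          moreover have "p + ?r = p + 1 + int (nat (?r - 1))" if "?r \<noteq> 0" using that r by simp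
          moreover have "nat (?r - 1) < L" if "?r \<noteq> 0" using that r True by linarith
          ultimately have "?r = 0" using before k by metis
          then show "int n dvd k - p" by (simp add: dvd_eq_mod_eq_0)
        next
          assume "int n dvd k - p"
          then show "a k = 2" using p coloring_cong[OF a, of k p] by (simp add: mod_eq_dvd_iff)
        qed
        then show ?thesis using a neq unfolding only_two_at_def by blast
      next
        case False
        then have L: "0 < L" "L < n - 1" using \<open>0 < L\<close> \<open>L \<le> n - 1\<close> by auto
        define b where "b = shift_segment n (p + 1) L 2 a"
        have ab: "coloring_step n a b" unfolding b_def
          using L L2 p before by (intro coloring_swap_segment[OF a]) auto
        then have b: "coloring n b" by (simp add: coloring_step_def)
        have "(p - (p + 1)) mod int n = int n - 1" using n by (simp add: zmod_minus1)
        then have bp: "b p = 2" using L p by (auto simp: b_def shift_segment_def)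
        have "(p - 1 - (p + 1)) mod int n = int n - 2"
          using L mod_add_self2[of "-2" "int n"] mod_pos_pos_trivial[of "int n - 2" "int n"] by simp
        then have "b (p - 1) = a (p - 1)" using L by (auto simp: b_def shift_segment_def)
        moreover have "b (p + 1) = a (p + 1) + 2" using L by (simp add: b_def shift_segment_def)
        moreover have "a (p - 1) = a (p + 1) + 2" using neq p1 nz by (intro Z4_alternate) auto
        ultimately obtain c where c: "coloring_step n b c" "card (twos n c) < card (twos n b)"
          using remove_two[OF b n bp] by auto
        have "twos n b \<subseteq> twos n a" 
          using nz by (auto simp: twos_def b_def shift_segment_def split: if_splits)
        then have "card (twos n b) \<le> card (twos n a)" by (intro card_mono finite_twos)
        then show ?thesis using progress[of b c] ab c by auto
      qed
    qed
  qed
qed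

text \<open>A colouring alternating between \<open>1\<close> and \<open>3\<close> closes up only on an even cycle, and its value at \<open>0\<close>
determines it.\<close>
lemma coloring_without_two:
  assumes a: "coloring n a" and n: "0 < n" and no: "\<And>k. a k \<noteq> 2"
  shows "even n" and "a k = (if even (nat (k mod int n)) then a 0 else a 0 + 2)"
proof -
  have "a (0 + int n) = a 0" using a unfolding coloring_def by blast
  then show "even n" using coloring_alternates[OF a, of n 0] no by (auto split: if_splits)
  have "a k = a (0 + int (nat (k mod int n)))"
    using n by (intro coloring_cong[OF a]) simp
  then show "a k = (if even (nat (k mod int n)) then a 0 else a 0 + 2)"
    using coloring_alternates[OF a, of _ 0] no by metis
qed

text \<open>Away from the single \<open>2\<close> the colours alternate along a path with \<open>n - 1\<close> vertices; its two ends are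
coloured differently exactly when \<open>n - 1\<close> is even.\<close>
lemma coloring_only_two:
  assumes a: "coloring n a" and n: "2 \<le> n" and p: "only_two_at n p a"
  shows "j < n - 1 \<Longrightarrow> a (p + 1 + int j) = (if even j then a (p + 1) else a (p + 1) + 2)"
    and "a (p - 1) \<noteq> a (p + 1) \<Longrightarrow> odd n"
    and "a k = (if int n dvd k - p then 2
       else if even (nat ((k - p) mod int n - 1)) then a (p + 1) else a (p + 1) + 2)"
proof -
  have alt: "a (p + 1 + int j) = (if even j then a (p + 1) else a (p + 1) + 2)" if "j < n - 1" for j
  proof (rule coloring_alternates[OF a])
    fix i assume "i \<le> j"
    then have "\<not> int n dvd 1 + int i" using that by (intro zdvd_not_zless) auto
    then show "a (p + 1 + int i) \<noteq> 2" using p by (simp add: only_two_at_def)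
  qed
  then show "j < n - 1 \<Longrightarrow> a (p + 1 + int j) = (if even j then a (p + 1) else a (p + 1) + 2)" .
  have "a (p + 1 + int (n - 2)) = a (p - 1)"
    using n by (intro coloring_cong[OF a]) (simp add: mod_eq_dvd_iff of_nat_diff)
  then show "a (p - 1) \<noteq> a (p + 1) \<Longrightarrow> odd n" using alt[of "n - 2"] n by (auto split: if_splits)
  show "a k = (if int n dvd k - p then 2
       else if even (nat ((k - p) mod int n - 1)) then a (p + 1) else a (p + 1) + 2)"
  proof (cases "int n dvd k - p")
    case True
    then show ?thesis using p by (simp add: only_two_at_def)
  next
    case False
    let ?r = "(k - p) mod int n"
    have r: "0 \<le> ?r" "?r < int n" "?r \<noteq> 0" using n False by (simp_all add: dvd_eq_mod_eq_0)
    have "a k = a (p + 1 + int (nat (?r - 1)))" using r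
      by (intro coloring_cong[OF a]) (simp add: mod_simps)
    then show ?thesis using alt[of "nat (?r - 1)"] r False by (simp add: nat_less_iff of_nat_diff)
  qed
qed

text \<open>With \<open>c\<close> the colour of \<open>p + 1\<close> and \<open>c' = c + 2\<close> the other odd colour, positions \<open>p - 1\<close> to \<open>p + 3\<close> read
\<open>c' 2 c c' c\<close>. Recolouring one vertex at a time gives \<open>c' 2 c 2 c\<close>, then \<open>c' 2 c' 2 c\<close>, then \<open>c' c c' 2 c\<close>.
The five positions must be distinct, which is where \<open>n \<ge> 5\<close> enters.\<close>
lemma move_only_two:
  assumes a: "coloring n a" and n: "5 \<le> n" "odd n" and p: "only_two_at n p a"
  shows "\<exists>b. (coloring_step n)\<^sup>*\<^sup>* a b \<and> coloring n b \<and> only_two_at n (p + 2) b"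
proof -
  have n2: "2 \<le> n" using n by simp
  have nd: "\<not> int n dvd m" if "0 < m" "m < 5" for m :: int
    using that n by (intro zdvd_not_zless) auto
  have nd': "\<not> int n dvd m" if "m < 0" "-5 < m" for m :: int
    using nd[of "- m"] that by simp
  define c where "c = a (p + 1)"
  have ap: "a p = 2" using p by (simp add: only_two_at_def)
  have c: "c \<noteq> 0" "c \<noteq> 2" using a ap unfolding c_def coloring_def by metis+
  then have c': "c + 2 \<noteq> 0" "c + 2 \<noteq> 2" by (auto simp: Z4_add_two_eq_0_iff)
  have a2: "a (p + 2) = c + 2" "a (p + 3) = c"
    using coloring_only_two(1)[OF a n2 p, of 1] coloring_only_two(1)[OF a n2 p, of 2] n
    by (auto simp: c_def algebra_simps)
  have am: "a (p - 1) = c + 2"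
  proof -
    have "a (p + 1 + int (n - 2)) = a (p - 1)"
      using n by (intro coloring_cong[OF a]) (simp add: mod_eq_dvd_iff of_nat_diff)
    then show ?thesis using coloring_only_two(1)[OF a n2 p, of "n - 2"] n by (simp add: c_def)
  qed
  define a1 where "a1 = (\<lambda>k. if int n dvd k - (p + 2) then 2 else a k)"
  define a2 where "a2 = (\<lambda>k. if int n dvd k - (p + 1) then c + 2 else a1 k)"
  define a3 where "a3 = (\<lambda>k. if int n dvd k - p then c else a2 k)"
  have a1v: "a1 (p - 1) = c + 2" "a1 p = 2" "a1 (p + 1) = c" "a1 (p + 2) = 2"
    using nd' [of "-3"] nd'[of "-2"] nd'[of "-1"] am ap by (simp_all add: a1_def c_def)
  then have a2v: "a2 (p - 1) = c + 2" "a2 p = 2" "a2 (p + 1) = c + 2" "a2 (p + 2) = 2"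
    using nd[of 1] nd'[of "-2"] nd'[of "-1"] by (simp_all add: a2_def)
  have s1: "coloring_step n a a1" unfolding a1_def
    using a2 c c_def by (intro coloring_recolor[OF a n2]) (auto simp: add.commute)
  then have s2: "coloring_step n a1 a2" unfolding a2_def
    using a1v c c' by (intro coloring_recolor[OF _ n2]) (auto simp: coloring_step_def algebra_simps)
  then have s3: "coloring_step n a2 a3" unfolding a3_def
    using a2v c c' by (intro coloring_recolor[OF _ n2]) (auto simp: coloring_step_def)
  have "a3 k = 2 \<longleftrightarrow> int n dvd k - (p + 2)" for k
  proof (cases "int n dvd k - (p + 2)")
    case True
    have "\<not> int n dvd k - (p + 1)" "\<not> int n dvd k - p"
      using dvd_diff[OF _ True, of "k - (p + 1)"] dvd_diff[OF _ True, of "k - p"] nd[of 1] nd[of 2] by auto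
    then show ?thesis using True by (simp add: a3_def a2_def a1_def)
  next
    case False
    then show ?thesis using p c c' by (simp add: a3_def a2_def a1_def only_two_at_def)
  qed
  then have "only_two_at n (p + 2) a3" by (simp add: only_two_at_def)
  moreover have "coloring n a3" using s3 by (simp add: coloring_step_def)
  moreover have "(coloring_step n)\<^sup>*\<^sup>* a a3" using s1 s2 s3 by auto
  ultimately show ?thesis by blast
qed

text \<open>As \<open>2\<close> is invertible modulo the odd number \<open>n\<close>, moves by two positions bring the single \<open>2\<close> to position \<open>0\<close>.
Swapping the whole remaining path then arranges the colour of position \<open>1\<close>.\<close>
lemma normalize_only_two:
  assumes a: "coloring n a" and n: "5 \<le> n" "odd n" and p: "only_two_at n p a"
  shows "\<exists>b. (coloring_step n)\<^sup>*\<^sup>* a b \<and> coloring n b \<and> only_two_at n 0 b \<and> b 1 = 1"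
proof -
  have "\<exists>b. (coloring_step n)\<^sup>*\<^sup>* a b \<and> coloring n b \<and> only_two_at n (p + 2 * int m) b" for m
  proof (induction m)
    case 0
    then show ?case using a p by auto
  next
    case (Suc m)
    then obtain b where "(coloring_step n)\<^sup>*\<^sup>* a b" "coloring n b" "only_two_at n (p + 2 * int m) b"
      by blast
    moreover have "p + 2 * int m + 2 = p + 2 * int (Suc m)" by simp
    ultimately show ?case using move_only_two[OF _ n] by (metis rtranclp_trans)
  qed
  moreover
  have "\<exists>m. int n dvd p + 2 * int m"
  proof -
    obtain t where t: "n = 2 * t + 1" using n(2) by (rule oddE)
    \<comment> \<open>With \<open>n = 2 t + 1\<close> one has \<open>p + 2 t p = n p\<close>; the residue \<open>q\<close> replaces \<open>p\<close> to keep the number of moves nonnegative.\<close>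
    define q where "q = p mod int n"
    have q: "0 \<le> q" using n by (simp add: q_def)
    have "int (nat (int t * q)) = int t * q" using q by simp
    then have "p + 2 * int (nat (int t * q)) = (p - q) + int n * q"
      by (simp add: t algebra_simps)
    moreover have "int n dvd p - q" by (simp add: q_def mod_eq_dvd_iff [symmetric])
    ultimately have "int n dvd p + 2 * int (nat (int t * q))" by (metis dvd_add dvd_triv_left)
    then show ?thesis by blast
  qed
  then obtain m where m: "int n dvd p + 2 * int m" by blast
  ultimately obtain b where b: "(coloring_step n)\<^sup>*\<^sup>* a b" "coloring n b" "only_two_at n (p + 2 * int m) b" by blast
  have b0: "only_two_at n 0 b"
  proof -
    have "int n dvd k - (p + 2 * int m) \<longleftrightarrow> int n dvd k" for k
      using m by (simp add: dvd_diff_left_iff)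
    then show ?thesis using b(3) by (simp add: only_two_at_def)
  qed
  have "b 0 = 2" using b0 by (simp add: only_two_at_def)
  moreover have "b (0 + 1) \<noteq> b 0" "b 1 \<noteq> 0" using b(2) unfolding coloring_def by metis+
  ultimately have "b 1 = 1 \<or> b 1 = 3" using Z4_exhaust[of "b 1"] by auto
  then show ?thesis
  proof
    assume b1: "b 1 = 3"
    define c where "c = shift_segment n 1 (n - 1) 2 b"
    have bc: "coloring_step n b c" unfolding c_def
    proof (rule coloring_swap_segment[OF b(2)])
      show "b (1 + int j) \<noteq> 2" if "j < n - 1" for j
      proof -
        have "\<not> int n dvd 1 + int j" using that by (intro zdvd_not_zless) auto
        then show ?thesis using b0 by (simp add: only_two_at_def)
      qed
    qed (use n b0 in \<open>auto simp: only_two_at_def of_nat_diff\<close>)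
    have "c 1 = 1" using n b1 by (simp add: c_def shift_segment_def)
    moreover have "only_two_at n 0 c"
      unfolding only_two_at_def
    proof
      fix k
      have "(k - 1) mod int n < int (n - 1) \<longleftrightarrow> \<not> int n dvd k"
      proof -
        have "k mod int n = (if (k - 1) mod int n = int n - 1 then 0 else (k - 1) mod int n + 1)"
          using succ_mod[of n "k - 1" 0] n by simp
        moreover have "0 \<le> (k - 1) mod int n" "(k - 1) mod int n < int n" "int (n - 1) = int n - 1"
          using n by simp_all
        ultimately show ?thesis unfolding dvd_eq_mod_eq_0 by (smt (verit))
      qed
      moreover have "b k + 2 \<noteq> 2" using b(2) by (simp add: coloring_def)
      ultimately show "c k = 2 \<longleftrightarrow> int n dvd k - 0"
        using b0 by (auto simp: c_def shift_segment_def only_two_at_def)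
    qed
    moreover have "coloring n c" using bc by (simp add: coloring_step_def)
    moreover have "(coloring_step n)\<^sup>*\<^sup>* a c" using b(1) bc by simp
    ultimately show ?thesis by blast
  qed (use b b0 in blast)
qed

section \<open>Cycles traced by periodic vertex sequences\<close>

definition traced_graph :: "(int \<Rightarrow> 'a) \<Rightarrow> 'a graph" where
  "traced_graph c = \<lparr>verts = range c, edges = range (\<lambda>k. {c k, c (k + 1)})\<rparr>"

text \<open>A closed walk without repeated vertices, written as a sequence indexed by all integers that repeats
with period \<open>m\<close>. Each vertex has its two neighbours in the sequence, and these differ because \<open>m \<ge> 3\<close>.\<close>
lemma traced_graph_is_cycle:
  fixes c :: "int \<Rightarrow> 'a"
  assumes m: "3 \<le> m" and c: "\<And>j k. c j = c k \<longleftrightarrow> j mod int m = k mod int m"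
  shows "is_cycle (traced_graph c)"
proof -
  let ?G = "traced_graph c"
  have near: "c (k + d) \<noteq> c k" if "0 < d" "d < 3" for k d :: int
  proof
    assume "c (k + d) = c k"
    then have "int m dvd d" by (simp add: c mod_eq_dvd_iff)
    then show False using that m by (auto dest: zdvd_imp_le)
  qed
  have "range c = c ` {0..<int m}"
  proof
    show "range c \<subseteq> c ` {0..<int m}"
    proof
      fix v assume "v \<in> range c"
      then obtain k where "v = c k" by blast
      then have "v = c (k mod int m)" by (simp add: c)
      then show "v \<in> c ` {0..<int m}" using m by simp
    qed
  qed auto
  then have "finite (range c)" by simp
  moreover have "card {c k, c (k + 1)} = 2" for k using near[of 1 k] by auto
  ultimately have "simple_graph ?G" by (auto simp: simple_graph_def traced_graph_def)
  moreover have "connected_graph ?G"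
  proof -
    let ?R = "{(x, y). {x, y} \<in> edges ?G}"
    have step: "(c k, c (k + 1)) \<in> ?R" "(c (k + 1), c k) \<in> ?R" for k
      by (auto simp: traced_graph_def insert_commute)
    have up: "(c k, c (k + int j)) \<in> ?R\<^sup>*" and down: "(c (k + int j), c k) \<in> ?R\<^sup>*" for k j
    proof (induction j)
      case (Suc j)
      have e: "k + int (Suc j) = (k + int j) + 1" by simp
      { case 1 show ?case unfolding e using Suc(1) step(1) by (rule rtrancl_into_rtrancl) }
      { case 2 show ?case unfolding e using step(2) Suc(2) by (rule converse_rtrancl_into_rtrancl) }
    qed auto
    have "(c k, c l) \<in> ?R\<^sup>*" for k l
    proof (cases "k \<le> l")
      case True then show ?thesis using up[of k "nat (l - k)"] by simp
    next
      case False then show ?thesis using down[of l "nat (k - l)"] by simp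
    qed
    then show ?thesis by (auto simp: connected_graph_def traced_graph_def)
  qed
  moreover have "degree ?G (c k) = 2" for k
  proof -
    have "e = {c (k - 1), c k} \<or> e = {c k, c (k + 1)}" if "e \<in> edges ?G" "c k \<in> e" for e
    proof -
      from that(1) have "\<exists>l. e = {c l, c (l + 1)}" by (auto simp: traced_graph_def)
      then obtain l where l: "e = {c l, c (l + 1)}" ..
      from that(2) have "c k = c l \<or> c k = c (l + 1)" unfolding l by blast
      then show ?thesis
      proof
        assume 1: "c k = c l"
        then have "c (k + 1) = c (l + 1)" unfolding c by (intro mod_add_cong) auto
        then show ?thesis using l 1 by simp
      next
        assume 2: "c k = c (l + 1)"
        then have "c (k - 1) = c (l + 1 - 1)" unfolding c by (intro mod_diff_cong) auto
        then show ?thesis using l 2 by simp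
      qed
    qed
    moreover have "{c (k - 1), c k} \<in> edges ?G" "{c k, c (k + 1)} \<in> edges ?G"
      by (auto simp: traced_graph_def intro: range_eqI[of _ _ "k - 1"])
    ultimately have "{e \<in> edges ?G. c k \<in> e} = {{c (k - 1), c k}, {c k, c (k + 1)}}" by auto
    moreover have "{c (k - 1), c k} \<noteq> {c k, c (k + 1)}"
      using near[of 2 "k - 1"] near[of 1 k] by (auto simp: doubleton_eq_iff add.commute)
    ultimately show ?thesis by (simp add: degree_def)
  qed
  then have "regular 2 ?G" by (auto simp: regular_def traced_graph_def)
  ultimately show ?thesis by (simp add: is_cycle_def)
qed

section \<open>Flow values along arcs\<close>

text \<open>The value of a flow read in the direction from \<open>u\<close> to \<open>v\<close>, whichever way the edge is oriented. In these
terms a flow no longer depends on the orientation.\<close>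
definition along :: "('a \<times> 'a) set \<Rightarrow> ('a set \<Rightarrow> 'b::ab_group_add) \<Rightarrow> 'a \<Rightarrow> 'a \<Rightarrow> 'b" where
  "along D f u v = (if (u, v) \<in> D then f {u, v} else - f {u, v})"

lemma orientation_edge_iff:
  assumes "orientation G D"
  shows "{u, v} \<in> edges G \<longleftrightarrow> (u, v) \<in> D \<or> (v, u) \<in> D"
proof -
  have D: "D \<subseteq> {(u, v). {u, v} \<in> edges G}"
    and dir: "{u, v} \<in> edges G \<longrightarrow> (u, v) \<in> D \<longleftrightarrow> (v, u) \<notin> D"
    using assms[unfolded orientation_def, THEN conjunct1]
      assms[unfolded orientation_def, THEN conjunct2, rule_format, of u v] by auto
  have "{v, u} \<in> edges G \<longleftrightarrow> {u, v} \<in> edges G" by (simp only: insert_commute)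
  then show ?thesis using D dir by blast
qed

lemma orientation_asym: "orientation G D \<Longrightarrow> (u, v) \<in> D \<Longrightarrow> (v, u) \<notin> D"
  using orientation_edge_iff[of G D u v] by (simp add: orientation_def)

lemma along_commute:
  assumes D: "orientation G D" and e: "{u, v} \<in> edges G"
  shows "along D f v u = - along D f u v"
  using e orientation_asym[OF D] unfolding orientation_edge_iff[OF D]
  by (auto simp: along_def insert_commute)

lemma along_eq_iff: "along D f u v = along D g u v \<longleftrightarrow> f {u, v} = g {u, v}"
  by (simp add: along_def)

lemma along_eq_0_iff: "along D f u v = 0 \<longleftrightarrow> f {u, v} = 0"
  by (simp add: along_def)

lemma net_outflow_eq_sum_along:
  assumes G: "simple_graph G" and D: "orientation G D"
  shows "(\<Sum>e\<in>out_edges D v. f e) - (\<Sum>e\<in>in_edges D v. f e) = (\<Sum>u | {v, u} \<in> edges G. along D f v u)"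
proof -
  have "{u. {v, u} \<in> edges G} \<subseteq> verts G" using G by (auto simp: simple_graph_def)
  then have fin: "finite {u. {v, u} \<in> edges G}" using G by (auto simp: simple_graph_def intro: finite_subset)
  have inj: "inj_on (\<lambda>u. {v, u}) X" for X by (auto simp: inj_on_def doubleton_eq_iff)
  have split: "{u. {v, u} \<in> edges G} = {u. (v, u) \<in> D} \<union> {u. (u, v) \<in> D}"
    unfolding orientation_edge_iff[OF D] by blast
  have disj: "{u. (v, u) \<in> D} \<inter> {u. (u, v) \<in> D} = {}"
    using orientation_asym[OF D] by blast
  have "out_edges D v = (\<lambda>u. {v, u}) ` {u. (v, u) \<in> D}" by (auto simp: out_edges_def)
  then have "(\<Sum>e\<in>out_edges D v. f e) = (\<Sum>u | (v, u) \<in> D. f {v, u})"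
    by (simp add: sum.reindex[OF inj])
  also have "\<dots> = (\<Sum>u | (v, u) \<in> D. along D f v u)" by (intro sum.cong) (auto simp: along_def)
  finally have out: "(\<Sum>e\<in>out_edges D v. f e) = (\<Sum>u | (v, u) \<in> D. along D f v u)" .
  have "in_edges D v = (\<lambda>u. {v, u}) ` {u. (u, v) \<in> D}" by (auto simp: in_edges_def insert_commute)
  then have "(\<Sum>e\<in>in_edges D v. f e) = (\<Sum>u | (u, v) \<in> D. f {v, u})"
    by (simp add: sum.reindex[OF inj])
  also have "\<dots> = (\<Sum>u | (u, v) \<in> D. - along D f v u)"
    using disj by (intro sum.cong) (auto simp: along_def)
  finally have "- (\<Sum>e\<in>in_edges D v. f e) = (\<Sum>u | (u, v) \<in> D. along D f v u)"
    by (simp add: sum_negf)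
  moreover have "(\<Sum>u | {v, u} \<in> edges G. along D f v u)
      = (\<Sum>u | (v, u) \<in> D. along D f v u) + (\<Sum>u | (u, v) \<in> D. along D f v u)"
    using fin disj unfolding split by (intro sum.union_disjoint) auto
  ultimately show ?thesis by (simp only: diff_conv_add_uminus out)
qed

lemma flow_iff_along:
  assumes "simple_graph G" "orientation G D"
  shows "flow G D f \<longleftrightarrow> f \<in> edges G \<rightarrow>\<^sub>E (UNIV - {0}) \<and>
    (\<forall>v\<in>verts G. (\<Sum>u | {v, u} \<in> edges G. along D f v u) = 0)"
  unfolding flow_def net_outflow_eq_sum_along[OF assms] ..

text \<open>Conversely, every antisymmetric assignment of nonzero values to the directed edges comes from a
function on the edges: read off its value on the arc that the orientation chooses.\<close>
lemma along_realizable: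
  assumes G: "simple_graph G" and D: "orientation G D"
    and h: "\<And>u v. {u, v} \<in> edges G \<Longrightarrow> h v u = - h u v" "\<And>u v. {u, v} \<in> edges G \<Longrightarrow> h u v \<noteq> 0"
  shows "\<exists>f \<in> edges G \<rightarrow>\<^sub>E (UNIV - {0}). \<forall>u v. {u, v} \<in> edges G \<longrightarrow> along D f u v = h u v"
proof -
  \<comment> \<open>The arc of \<open>D\<close> with the two ends of \<open>e\<close> is unique.\<close>
  define f where "f = (\<lambda>e\<in>edges G. case_prod h (THE p. p \<in> D \<and> e = {fst p, snd p}))"
  have f: "f {u, v} = h u v" if "(u, v) \<in> D" for u v
  proof -
    have e: "{u, v} \<in> edges G" "(v, u) \<notin> D" using that orientation_edge_iff[OF D] orientation_asym[OF D] by blast+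
    have "(THE p. p \<in> D \<and> {u, v} = {fst p, snd p}) = (u, v)"
      using that e(2) by (intro the_equality) (auto simp: doubleton_eq_iff)
    then show ?thesis using e by (simp add: f_def)
  qed
  have dir: "(u, v) \<in> D \<or> (v, u) \<in> D" if "{u, v} \<in> edges G" for u v
    using that unfolding orientation_edge_iff[OF D] .
  have al: "along D f u v = h u v" if e: "{u, v} \<in> edges G" for u v
  proof (cases "(u, v) \<in> D")
    case False
    then have "f {v, u} = h v u" using dir[OF e] f by blast
    then show ?thesis using False h(1)[OF e] by (simp add: along_def insert_commute)
  qed (simp add: along_def f)
  have "f e \<noteq> 0" if "e \<in> edges G" for e
  proof -
    have "card e = 2" using G that by (auto simp: simple_graph_def)
    then obtain u v where "e = {u, v}" by (auto simp: card_2_iff)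
    then show ?thesis using that al h(2) along_eq_0_iff by metis
  qed
  moreover have "f \<in> extensional (edges G)" by (simp add: f_def)
  ultimately have "f \<in> edges G \<rightarrow>\<^sub>E (UNIV - {0})" by (auto simp: PiE_iff)
  then show ?thesis using al by blast
qed

lemma flow_adjacent_via_trace:
  assumes "flow G D f" "flow G D g" and G: "simple_graph G"
    and c: "3 \<le> m" "\<And>j k. c j = c k \<longleftrightarrow> j mod int m = k mod int m"
    and sub: "\<And>k. {c k, c (k + 1)} \<in> edges G"
    and eq: "\<And>e. e \<in> edges G \<Longrightarrow> f e \<noteq> g e \<Longrightarrow> \<exists>k. e = {c k, c (k + 1)}"
  shows "flow_adjacent G D f g"
proof -
  have cyc: "is_cycle (traced_graph c)" by (rule traced_graph_is_cycle[OF c])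
  have "c k \<in> verts G" for k using G sub[of k] by (auto simp: simple_graph_def)
  then have "subgraph (traced_graph c) G"
    using cyc sub by (auto simp: subgraph_def is_cycle_def traced_graph_def)
  moreover have "\<forall>e\<in>edges G - edges (traced_graph c). f e = g e"
    using eq by (auto simp: traced_graph_def)
  ultimately show ?thesis unfolding flow_adjacent_def using assms(1,2) cyc by blast
qed

lemma flow_adjacent_sym: "flow_adjacent G D f g \<Longrightarrow> flow_adjacent G D g f"
  unfolding flow_adjacent_def by (simp only: eq_commute[of "f _" "g _"] conj_ac)

lemma flow_equivalent_sym: "flow_equivalent G D f g \<Longrightarrow> flow_equivalent G D g f"
  unfolding flow_equivalent_def
  by (rule sympD[OF symp_rtranclp]) (auto intro: sympI flow_adjacent_sym)

lemma flow_adjacent_imp_equivalent: "flow_adjacent G D f g \<Longrightarrow> flow_equivalent G D f g"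
  unfolding flow_equivalent_def by (rule r_into_rtranclp)

lemma flow_equivalent_trans:
  "flow_equivalent G D f g \<Longrightarrow> flow_equivalent G D g h \<Longrightarrow> flow_equivalent G D f h"
  unfolding flow_equivalent_def by (rule rtranclp_trans)

section \<open>Vertices and edges of the prism\<close>

text \<open>Vertex \<open>k\<close> of the outer (\<open>x = 0\<close>) or inner (\<open>x = 1\<close>) rim, with \<open>k\<close> any integer, read modulo \<open>n\<close>.\<close>
definition prism_vertex :: "nat \<Rightarrow> nat \<Rightarrow> int \<Rightarrow> nat \<times> nat" where
  "prism_vertex n x k = (nat (k mod int n), x)"

lemma prism_vertex_eq_iff:
  assumes "0 < n"
  shows "prism_vertex n x k = prism_vertex n y l \<longleftrightarrow> x = y \<and> k mod int n = l mod int n"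
  using assms by (auto simp: prism_vertex_def eq_nat_nat_iff)

lemma prism_vertex_int: "i < n \<Longrightarrow> prism_vertex n x (int i) = (i, x)"
  by (simp add: prism_vertex_def)

lemma prism_vertex_int_succ: "prism_vertex n x (int i + 1) = ((i + 1) mod n, x)"
proof -
  have "(int i + 1) mod int n = int ((i + 1) mod n)" by (simp add: zmod_int add.commute)
  then show ?thesis by (simp add: prism_vertex_def)
qed

lemma verts_prism_eq:
  assumes "0 < n"
  shows "verts (prism n) = {prism_vertex n x k | x k. x < 2}"
proof
  show "verts (prism n) \<subseteq> {prism_vertex n x k | x k. x < 2}"
  proof
    fix v assume "v \<in> verts (prism n)"
    then obtain i x where "i < n" "x < 2" "v = (i, x)" by (auto simp: prism_verts)
    then have "v = prism_vertex n x (int i)" "x < 2" by (simp_all add: prism_vertex_int)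
    then show "v \<in> {prism_vertex n x k | x k. x < 2}" by blast
  qed
  show "{prism_vertex n x k | x k. x < 2} \<subseteq> verts (prism n)"
    using assms by (auto simp: prism_verts prism_vertex_def less_2_cases_iff nat_less_iff)
qed

lemma edges_prism_eq:
  assumes n: "0 < n"
  shows "edges (prism n) = {{prism_vertex n x k, prism_vertex n x (k + 1)} | x k. x < 2} \<union>
     {{prism_vertex n 0 k, prism_vertex n 1 k} | k. True}" (is "_ = ?R")
proof
  show "edges (prism n) \<subseteq> ?R"
  proof
    fix e assume "e \<in> edges (prism n)"
    then obtain i where i: "i < n"
      and "e = {(i, 0), ((i + 1) mod n, 0)} \<or> e = {(i, 1), ((i + 1) mod n, 1)} \<or> e = {(i, 0), (i, 1)}"
      unfolding prism_edges by blast
    then have "(\<exists>x<2. e = {prism_vertex n x (int i), prism_vertex n x (int i + 1)}) \<or>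
      e = {prism_vertex n 0 (int i), prism_vertex n 1 (int i)}"
      unfolding prism_vertex_int_succ by (simp add: prism_vertex_int less_2_cases_iff ex_disj_distrib conj_disj_distribR) 
    then show "e \<in> ?R" by blast
  qed
  have v: "prism_vertex n x k = (nat (k mod int n), x)" "prism_vertex n x (k + 1) = ((nat (k mod int n) + 1) mod n, x)" for x k
  proof -
    have "prism_vertex n x (k + 1) = prism_vertex n x (int (nat (k mod int n)) + 1)"
      using n by (simp add: prism_vertex_eq_iff mod_simps)
    then show "prism_vertex n x (k + 1) = ((nat (k mod int n) + 1) mod n, x)"
      by (simp only: prism_vertex_int_succ)
  qed (simp add: prism_vertex_def)
  have "nat (k mod int n) < n" for k using n by (simp add: nat_less_iff)
  note index = this
  have rims: "{(i, 0), ((i + 1) mod n, 0)} \<in> edges (prism n)" "{(i, 1), ((i + 1) mod n, 1)} \<in> edges (prism n)"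
    and rung: "{(i, 0), (i, 1)} \<in> edges (prism n)" if "i < n" for i
    using that unfolding prism_edges by blast+
  show "?R \<subseteq> edges (prism n)"
  proof
    fix e assume "e \<in> ?R"
    then consider x k where "e = {prism_vertex n x k, prism_vertex n x (k + 1)}" "x = 0 \<or> x = 1"
      | k where "e = {prism_vertex n 0 k, prism_vertex n 1 k}"
      by (auto simp: less_2_cases_iff)
    then show "e \<in> edges (prism n)"
    proof cases
      case 1
      then have "e = {(nat (k mod int n), x), ((nat (k mod int n) + 1) mod n, x)}"
        by (simp only: v(2) v(1)[of x k])
      then show ?thesis using rims[OF index, of k] \<open>x = 0 \<or> x = 1\<close> by (elim disjE) (simp_all only:)
    next
      case 2
      then show ?thesis unfolding v using rung[OF index] by simp
    qed
  qed
qed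

lemma prism_neighbors:
  assumes n: "3 \<le> n" and x: "x < 2"
  shows "{u. {prism_vertex n x k, u} \<in> edges (prism n)} =
    {prism_vertex n x (k + 1), prism_vertex n x (k - 1), prism_vertex n (1 - x) k}" (is "?N = ?R")
proof
  have n0: "0 < n" using n by simp
  show "?N \<subseteq> ?R"
  proof
    fix u assume "u \<in> ?N"
    then consider y l where "{prism_vertex n x k, u} = {prism_vertex n y l, prism_vertex n y (l + 1)}"
      | l where "{prism_vertex n x k, u} = {prism_vertex n 0 l, prism_vertex n 1 l}"
      unfolding edges_prism_eq[OF n0] by blast
    then show "u \<in> ?R"
    proof cases
      case 1
      then consider "prism_vertex n x k = prism_vertex n y l" "u = prism_vertex n y (l + 1)"
        | "prism_vertex n x k = prism_vertex n y (l + 1)" "u = prism_vertex n y l"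
        by (auto simp: doubleton_eq_iff)
      then show ?thesis
      proof cases
        case 1
        then have "u = prism_vertex n x (k + 1)"
          using n0 by (auto simp: prism_vertex_eq_iff intro: mod_add_cong)
        then show ?thesis by simp
      next
        case 2
        then have k: "k mod int n = (l + 1) mod int n" and "x = y"
          using n0 by (auto simp: prism_vertex_eq_iff)
        moreover have "(k - 1) mod int n = l mod int n" using mod_diff_cong[OF k refl, of 1] by simp
        ultimately have "u = prism_vertex n x (k - 1)"
          using n0 2 by (auto simp: prism_vertex_eq_iff)
        then show ?thesis by simp
      qed
    next
      case 2
      then show ?thesis using n0 by (auto simp: doubleton_eq_iff prism_vertex_eq_iff)
    qed
  qed
  have "{prism_vertex n x k, prism_vertex n x (k + 1)} \<in> edges (prism n)"
    "{prism_vertex n x (k - 1), prism_vertex n x (k - 1 + 1)} \<in> edges (prism n)"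
    "{prism_vertex n 0 k, prism_vertex n 1 k} \<in> edges (prism n)"
    unfolding edges_prism_eq[OF n0] using x by blast+
  then show "?R \<subseteq> ?N" using x by (auto simp: insert_commute less_2_cases_iff)
qed

lemma sum_prism_neighbors:
  fixes h :: "nat \<times> nat \<Rightarrow> 'b::ab_group_add"
  assumes n: "3 \<le> n" and x: "x < 2"
  shows "(\<Sum>u | {prism_vertex n x k, u} \<in> edges (prism n). h u) =
    h (prism_vertex n x (k + 1)) + h (prism_vertex n x (k - 1)) + h (prism_vertex n (1 - x) k)"
proof -
  have "\<not> int n dvd 2" using n by (auto dest: zdvd_imp_le)
  then have "prism_vertex n x (k + 1) \<noteq> prism_vertex n x (k - 1)"
    using n by (simp add: prism_vertex_eq_iff mod_eq_dvd_iff)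
  moreover have "prism_vertex n x l \<noteq> prism_vertex n (1 - x) k" for l
    using n x by (auto simp: prism_vertex_eq_iff less_2_cases_iff)
  ultimately show ?thesis unfolding prism_neighbors[OF n x] by (simp add: add.assoc)
qed

section \<open>Flows on the prism\<close>
definition rim_flow :: "nat \<Rightarrow> ((nat \<times> nat) \<times> (nat \<times> nat)) set \<Rightarrow>
    ((nat \<times> nat) set \<Rightarrow> 'b::ab_group_add) \<Rightarrow> nat \<Rightarrow> int \<Rightarrow> 'b" where
  "rim_flow n D f x k = along D f (prism_vertex n x k) (prism_vertex n x (k + 1))"

definition rung_flow :: "nat \<Rightarrow> ((nat \<times> nat) \<times> (nat \<times> nat)) set \<Rightarrow>
    ((nat \<times> nat) set \<Rightarrow> 'b::ab_group_add) \<Rightarrow> int \<Rightarrow> 'b" where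
  "rung_flow n D f k = along D f (prism_vertex n 0 k) (prism_vertex n 1 k)"

text \<open>Conservation at vertex \<open>k\<close> of either rim expresses the rung at \<open>k\<close> as the difference of consecutive
rim values, with opposite signs on the two rims.\<close>
lemma prism_flow_iff:
  fixes f :: "(nat \<times> nat) set \<Rightarrow> 'b::ab_group_add"
  assumes n: "3 \<le> n" and D: "orientation (prism n) D"
  shows "flow (prism n) D f \<longleftrightarrow> f \<in> edges (prism n) \<rightarrow>\<^sub>E (UNIV - {0}) \<and>
    (\<forall>k. rung_flow n D f k = rim_flow n D f 0 (k - 1) - rim_flow n D f 0 k \<and>
         rung_flow n D f k = rim_flow n D f 1 k - rim_flow n D f 1 (k - 1))"
proof -
  have n0: "0 < n" using n by simp
  have rim_edge: "{prism_vertex n x k, prism_vertex n x (k + 1)} \<in> edges (prism n)" if "x < 2" for x k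
    unfolding edges_prism_eq[OF n0] using that by blast
  have rung_edge: "{prism_vertex n 0 k, prism_vertex n 1 k} \<in> edges (prism n)" for k
    unfolding edges_prism_eq[OF n0] by blast
  have pred: "along D f (prism_vertex n x k) (prism_vertex n x (k - 1)) = - rim_flow n D f x (k - 1)"
    if "x < 2" for x k
    using along_commute[OF D rim_edge[OF that, of "k - 1"]] by (simp add: rim_flow_def)
  have up: "along D f (prism_vertex n 1 k) (prism_vertex n 0 k) = - rung_flow n D f k" for k
    using along_commute[OF D rung_edge] by (simp add: rung_flow_def)
  have sum0: "(\<Sum>u | {prism_vertex n 0 k, u} \<in> edges (prism n). along D f (prism_vertex n 0 k) u) =
      rim_flow n D f 0 k - rim_flow n D f 0 (k - 1) + rung_flow n D f k" for k
    by (subst sum_prism_neighbors[OF n]) (simp_all add: pred, simp_all add: rim_flow_def rung_flow_def)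
  have sum1: "(\<Sum>u | {prism_vertex n 1 k, u} \<in> edges (prism n). along D f (prism_vertex n 1 k) u) =
      rim_flow n D f 1 k - rim_flow n D f 1 (k - 1) - rung_flow n D f k" for k
    by (subst sum_prism_neighbors[OF n]) (simp_all add: pred up[simplified], simp_all add: rim_flow_def rung_flow_def)
  have "(\<forall>v\<in>verts (prism n). P v) \<longleftrightarrow> (\<forall>k. P (prism_vertex n 0 k) \<and> P (prism_vertex n 1 k))" for P
    unfolding verts_prism_eq[OF n0] less_2_cases_iff One_nat_def by blast
  moreover have "x - y + z = 0 \<longleftrightarrow> z = y - x" "x - y - z = 0 \<longleftrightarrow> z = x - y" for x y z :: 'b
    by (auto simp: algebra_simps)
  ultimately show ?thesis
    unfolding flow_iff_along[OF simple_graph_prism[OF n] D] by (simp only: sum0 sum1)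
qed

lemma rim_flow_cong:
  assumes "k mod int n = l mod int n"
  shows "rim_flow n D f x k = rim_flow n D f x l"
  using assms mod_add_cong[OF assms refl, of 1] by (simp add: rim_flow_def prism_vertex_def)

lemma prism_edge_cases:
  assumes n: "0 < n" and e: "e \<in> edges (prism n)"
  obtains (rim) x k where "x < 2" "e = {prism_vertex n x k, prism_vertex n x (k + 1)}"
    | (rung) k where "e = {prism_vertex n 0 k, prism_vertex n 1 k}"
  using e unfolding edges_prism_eq[OF n] by blast

lemma prism_rim_edge:
  assumes "0 < n" "x < 2"
  shows "{prism_vertex n x k, prism_vertex n x (k + 1)} \<in> edges (prism n)"
  using assms(2) unfolding edges_prism_eq[OF assms(1)] by blast

lemma prism_rung_edge:
  assumes "0 < n"
  shows "{prism_vertex n 0 k, prism_vertex n 1 k} \<in> edges (prism n)"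
  unfolding edges_prism_eq[OF assms] by blast

text \<open>The two rims determine the flow, and rim values are admissible when they are nonzero and
both rims demand the same nonzero value on every rung.\<close>
lemma prism_flow_exists:
  fixes r :: "nat \<Rightarrow> int \<Rightarrow> 'b::ab_group_add"
  assumes n: "3 \<le> n" and D: "orientation (prism n) D"
    and per: "\<And>x k. r x (k + int n) = r x k" and nz: "\<And>x k. r x k \<noteq> 0"
    and rung: "\<And>k. r 0 (k - 1) - r 0 k = r 1 k - r 1 (k - 1)" "\<And>k. r 0 (k - 1) \<noteq> r 0 k"
  shows "\<exists>f. flow (prism n) D f \<and> (\<forall>x<2. rim_flow n D f x = r x)"
proof -
  have n0: "0 < n" using n by simp
  have cong: "r x k = r x l" if "k mod int n = l mod int n" for x k l
    using that by (rule periodic_cong[where a = "r x", OF per])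
  have cong': "r x (k mod int n) = r x k" "r x (k mod int n - 1) = r x (k - 1)" for x k
    by (rule cong; simp add: mod_simps)+
  define h :: "nat \<times> nat \<Rightarrow> nat \<times> nat \<Rightarrow> 'b" where
    "h = (\<lambda>(i, x) (j, y). if x = y then if int n dvd int j - int i - 1 then r x (int i) else - r x (int j)
      else if x = 0 then r 0 (int i - 1) - r 0 (int i) else r 0 (int i) - r 0 (int i - 1))"
  have fwd: "int n dvd (k + 1) mod int n - k mod int n - 1" for k
  proof -
    have "int n dvd ((k + 1) mod int n - (k + 1)) - (k mod int n - k)"
      by (rule dvd_diff) (simp_all add: mod_eq_dvd_iff [symmetric])
    then show ?thesis by (simp add: algebra_simps)
  qed
  \<comment> \<open>Forward and backward rim edges are told apart because \<open>n\<close> does not divide \<open>2\<close>.\<close>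
  have bwd: "\<not> int n dvd k mod int n - (k + 1) mod int n - 1" for k
  proof -
    have "\<not> int n dvd 2" using n by (auto dest: zdvd_imp_le)
    moreover have "int n dvd (k mod int n - k) - ((k + 1) mod int n - (k + 1))"
      by (rule dvd_diff) (simp_all add: mod_eq_dvd_iff [symmetric])
    then have "int n dvd (k mod int n - (k + 1) mod int n - 1) + 2" by (simp add: algebra_simps)
    ultimately show ?thesis by (metis dvd_add_right_iff)
  qed
  have int_nat: "int (nat (k mod int n)) = k mod int n" for k using n by simp
  have h_rim: "h (prism_vertex n x k) (prism_vertex n x (k + 1)) = r x k"
      "h (prism_vertex n x (k + 1)) (prism_vertex n x k) = - r x k" for x k
    unfolding h_def prism_vertex_def prod.case int_nat using fwd bwd by (simp_all add: cong')
  have h_rung: "h (prism_vertex n 0 k) (prism_vertex n 1 k) = r 0 (k - 1) - r 0 k"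
    "h (prism_vertex n 1 k) (prism_vertex n 0 k) = r 0 k - r 0 (k - 1)" for k
    unfolding h_def prism_vertex_def prod.case int_nat by (simp_all add: cong')
  have h: "h v u = - h u v \<and> h u v \<noteq> 0" if "{u, v} \<in> edges (prism n)" for u v
    using n0 that
  proof (cases rule: prism_edge_cases)
    case (rim x k)
    then show ?thesis using nz by (auto simp: doubleton_eq_iff h_rim)
  next
    case (rung k)
    then have "u = prism_vertex n 0 k \<and> v = prism_vertex n 1 k \<or> u = prism_vertex n 1 k \<and> v = prism_vertex n 0 k"
      by (simp add: doubleton_eq_iff)
    then show ?thesis using assms(6)[of k] h_rung[of k] by (elim disjE) simp_all
  qed
  obtain f where f: "f \<in> edges (prism n) \<rightarrow>\<^sub>E (UNIV - {0})"
    and along: "\<And>u v. {u, v} \<in> edges (prism n) \<Longrightarrow> along D f u v = h u v"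
    using along_realizable[OF simple_graph_prism[OF n] D, of h] h by blast
  have rims: "rim_flow n D f x k = r x k" if "x < 2" for x k
    unfolding rim_flow_def along[OF prism_rim_edge[OF n0 that]] by (rule h_rim)
  moreover have "rung_flow n D f k = r 0 (k - 1) - r 0 k" for k
    unfolding rung_flow_def along[OF prism_rung_edge[OF n0]] by (rule h_rung)
  ultimately have "flow (prism n) D f"
    unfolding prism_flow_iff[OF n D] using f rung(1) by simp
  then show ?thesis using rims by blast
qed

lemma rung_flow_eq:
  fixes f :: "(nat \<times> nat) set \<Rightarrow> 'b::ab_group_add"
  assumes "3 \<le> n" "orientation (prism n) D" "flow (prism n) D f"
  shows "rung_flow n D f k = rim_flow n D f 0 (k - 1) - rim_flow n D f 0 k"
    and "rung_flow n D f k = rim_flow n D f 1 k - rim_flow n D f 1 (k - 1)"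
  using assms(3) unfolding prism_flow_iff[OF assms(1,2)] by blast+

lemma prism_flow_nonzero:
  fixes f :: "(nat \<times> nat) set \<Rightarrow> 'b::ab_group_add"
  assumes n: "3 \<le> n" and f: "flow (prism n) D f"
  shows "x < 2 \<Longrightarrow> rim_flow n D f x k \<noteq> 0" and "rung_flow n D f k \<noteq> 0"
proof -
  have n0: "0 < n" using n by simp
  have nz: "f e \<noteq> 0" if "e \<in> edges (prism n)" for e using f that by (auto simp: flow_def)
  show "x < 2 \<Longrightarrow> rim_flow n D f x k \<noteq> 0" 
    unfolding rim_flow_def along_eq_0_iff by (intro nz prism_rim_edge[OF n0])
  show "rung_flow n D f k \<noteq> 0"
    unfolding rung_flow_def along_eq_0_iff by (intro nz prism_rung_edge[OF n0])
qed

lemma prism_flow_eq_if_rims_eq: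
  fixes f g :: "(nat \<times> nat) set \<Rightarrow> 'b::ab_group_add"
  assumes n: "3 \<le> n" and D: "orientation (prism n) D"
    and f: "flow (prism n) D f" and g: "flow (prism n) D g"
    and eq: "\<And>x. x < 2 \<Longrightarrow> rim_flow n D f x = rim_flow n D g x"
  shows "f = g"
proof
  fix e
  have n0: "0 < n" using n by simp
  show "f e = g e"
  proof (cases "e \<in> edges (prism n)")
    case True
    with n0 show ?thesis
    proof (cases rule: prism_edge_cases)
      case (rim x k)
      then show ?thesis using fun_cong[OF eq, of x k] by (simp add: rim_flow_def along_eq_iff)
    next
      case (rung k)
      have "rung_flow n D f k = rung_flow n D g k"
        using rung_flow_eq(1)[OF n D f] rung_flow_eq(1)[OF n D g] eq by simp
      then show ?thesis using rung by (simp add: rung_flow_def along_eq_iff)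
    qed
  next
    case False
    have "f e = undefined"
      by (rule PiE_arb[OF conjunct1[OF f[unfolded flow_def]] False])
    moreover have "g e = undefined"
      by (rule PiE_arb[OF conjunct1[OF g[unfolded flow_def]] False])
    ultimately show ?thesis by simp
  qed
qed

text \<open>Flows that agree on one rim agree on all rungs, so they differ only on the cycle formed by the
other rim.\<close>
lemma flow_adjacent_along_rim:
  fixes f g :: "(nat \<times> nat) set \<Rightarrow> 'b::ab_group_add"
  assumes n: "3 \<le> n" and D: "orientation (prism n) D"
    and f: "flow (prism n) D f" and g: "flow (prism n) D g"
    and x: "x < 2" and eq: "rim_flow n D f (1 - x) = rim_flow n D g (1 - x)"
  shows "flow_adjacent (prism n) D f g"
proof (rule flow_adjacent_via_trace[OF f g simple_graph_prism[OF n] n])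
  have n0: "0 < n" using n by simp
  show "prism_vertex n x j = prism_vertex n x k \<longleftrightarrow> j mod int n = k mod int n" for j k
    by (simp add: prism_vertex_eq_iff[OF n0])
  show "{prism_vertex n x k, prism_vertex n x (k + 1)} \<in> edges (prism n)" for k
    by (rule prism_rim_edge[OF n0 x])
  fix e assume "e \<in> edges (prism n)" and ne: "f e \<noteq> g e"
  with n0 show "\<exists>k. e = {prism_vertex n x k, prism_vertex n x (k + 1)}"
  proof (cases rule: prism_edge_cases)
    case (rim y k)
    have "y \<noteq> 1 - x"
    proof
      assume "y = 1 - x"
      then show False using ne rim fun_cong[OF eq, of k] by (simp add: rim_flow_def along_eq_iff)
    qed
    then have "y = x" using x rim(1) by linarith
    then show ?thesis using rim by blast
  next
    case (rung k)
    have "1 - x = 0 \<or> 1 - x = 1" by linarith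
    then have "rung_flow n D f k = rung_flow n D g k"
      using rung_flow_eq[OF n D f, of k] rung_flow_eq[OF n D g, of k] eq by (elim disjE) simp_all
    then show ?thesis using ne rung by (simp add: rung_flow_def along_eq_iff)
  qed
qed

text \<open>If on each rim the difference of the flows is constant on the same segment of \<open>L\<close> consecutive edges and zero
elsewhere, then the rungs agree except at the two ends of the segment. So the flows differ only on
the rectangle formed by the two segments and these two rungs.\<close>
lemma flow_adjacent_along_rectangle:
  fixes f g :: "(nat \<times> nat) set \<Rightarrow> 'b::ab_group_add"
  assumes n: "3 \<le> n" and D: "orientation (prism n) D"
    and f: "flow (prism n) D f" and g: "flow (prism n) D g"
    and L: "0 < L" "L < n"
    and diff: "\<And>x k. x < 2 \<Longrightarrow>
      rim_flow n D g x k = (if (k - i) mod int n < int L then rim_flow n D f x k + d x else rim_flow n D f x k)"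
  shows "flow_adjacent (prism n) D f g"
proof -
  have n0: "0 < n" using n by simp
  define m where "m = 2 * L + 2"
  have m0: "0 < m" and im: "int m = 2 * int L + 2" by (simp_all add: m_def)
  \<comment> \<open>The rectangle: \<open>L + 1\<close> vertices of the outer rim forwards, then \<open>L + 1\<close> vertices of the inner rim backwards.\<close>
  define c where "c = (\<lambda>j. let r = j mod int m in
    if r \<le> int L then prism_vertex n 0 (i + r) else prism_vertex n 1 (i + 2 * int L + 1 - r))"
  have c_low: "c j = prism_vertex n 0 (i + j)" if "0 \<le> j" "j \<le> int L" for j
    using that by (simp add: c_def im)
  have c_high: "c j = prism_vertex n 1 (i + 2 * int L + 1 - j)" if "int L < j" "j < int m" for j
    using that by (simp add: c_def im)
  have c_mod: "c j = c (j mod int m)" for j by (simp add: c_def)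
  have c_wrap: "c (int m) = prism_vertex n 0 i" using c_mod[of "int m"] c_low[of 0] by simp
  have range: "0 \<le> j mod int m \<and> j mod int m < int m" for j using m0 by simp
  have close: "s = t" if "s mod int n = t mod int n" "\<bar>s - t\<bar> \<le> int L" for s t
  proof (rule ccontr)
    assume "s \<noteq> t"
    moreover have "int n dvd s - t" using that(1) by (simp add: mod_eq_dvd_iff)
    ultimately have "int n \<le> \<bar>s - t\<bar>" using zdvd_imp_le[of "int n" "\<bar>s - t\<bar>"] by simp
    then show False using that L by simp
  qed
  have c_inj: "s = t" if st: "c s = c t" "0 \<le> s" "s < int m" "0 \<le> t" "t < int m" for s t
  proof -
    consider "s \<le> int L" "t \<le> int L" | "s \<le> int L" "int L < t" | "int L < s" "t \<le> int L" | "int L < s" "int L < t"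
      by linarith
    then show ?thesis
    proof cases
      case 1
      then have "(i + s) mod int n = (i + t) mod int n" using st by (simp add: c_low prism_vertex_eq_iff[OF n0])
      then have "i + s = i + t" by (rule close) (use 1 st in linarith)
      then show ?thesis by simp
    next
      case 4
      then have "(i + 2 * int L + 1 - s) mod int n = (i + 2 * int L + 1 - t) mod int n"
        using st by (simp add: c_high prism_vertex_eq_iff[OF n0])
      then have "i + 2 * int L + 1 - s = i + 2 * int L + 1 - t" by (rule close) (use 4 st im in linarith)
      then show ?thesis by simp
    qed (use st in \<open>simp_all add: c_low c_high prism_vertex_eq_iff[OF n0]\<close>)
  qed
  show ?thesis
  proof (rule flow_adjacent_via_trace[OF f g simple_graph_prism[OF n]])
    show "3 \<le> m" using L by (simp add: m_def)
    show "c j = c k \<longleftrightarrow> j mod int m = k mod int m" for j k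
      using c_inj[of "j mod int m" "k mod int m"] range[of j] range[of k] c_mod[of j] c_mod[of k] by metis
    show "{c k, c (k + 1)} \<in> edges (prism n)" for k
    proof -
      define r where "r = k mod int m"
      have r: "0 \<le> r" "r < int m" using range[of k] by (simp_all add: r_def)
      have "c (k + 1) = c (r + 1)" using c_mod[of "k + 1"] c_mod[of "r + 1"] by (simp add: r_def mod_simps)
      moreover have "c k = c r" using c_mod[of k] by (simp add: r_def)
      moreover have "{c r, c (r + 1)} \<in> edges (prism n)"
      proof -
        consider "r < int L" | "r = int L" | "int L < r" "r + 1 < int m" | "r + 1 = int m"
          using r by linarith
        then show ?thesis
        proof cases
          case 1
          then show ?thesis using r prism_rim_edge[OF n0, of 0 "i + r"] by (simp add: c_low add.assoc)
        next
          case 2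
          then have "c r = prism_vertex n 0 (i + int L)" "c (r + 1) = prism_vertex n 1 (i + int L)"
            using c_low[of r] c_high[of "r + 1"] im by (auto simp: add.commute)
          then show ?thesis using prism_rung_edge[OF n0] by simp
        next
          case 3
          then show ?thesis using r prism_rim_edge[OF n0, of 1 "i + 2 * int L - r"]
            by (simp add: c_high insert_commute algebra_simps)
        next
          case 4
          then have "c r = prism_vertex n 1 i" "c (r + 1) = prism_vertex n 0 i"
            using c_high[of r] c_wrap im L by (simp_all add: add.commute)
          then show ?thesis using prism_rung_edge[OF n0, of i] by (simp add: insert_commute)
        qed
      qed
      ultimately show ?thesis by simp
    qed
    fix e assume "e \<in> edges (prism n)" and ne: "f e \<noteq> g e"
    with n0 show "\<exists>k. e = {c k, c (k + 1)}"
    proof (cases rule: prism_edge_cases)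
      case (rim x k)
      define r where "r = (k - i) mod int n"
      have "rim_flow n D f x k \<noteq> rim_flow n D g x k"
        using ne rim by (simp add: rim_flow_def along_eq_iff)
      then have r: "0 \<le> r" "r < int L" using diff[OF rim(1), of k] n0 by (auto simp: r_def split: if_splits)
      have kr: "k mod int n = (i + r) mod int n" by (simp add: r_def mod_simps)
      have V: "prism_vertex n x k = prism_vertex n x (i + r)"
        "prism_vertex n x (k + 1) = prism_vertex n x (i + r + 1)"
        unfolding prism_vertex_eq_iff[OF n0] using kr mod_add_cong[OF kr refl, of 1] by simp_all
      have "x = 0 \<or> x = 1" using rim(1) by linarith
      then show ?thesis
      proof
        assume "x = 0"
        then have "e = {c r, c (r + 1)}" using rim(2) V r by (simp add: c_low add.assoc)
        then show ?thesis ..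
      next
        assume "x = 1"
        moreover have "c (2 * int L - r) = prism_vertex n 1 (i + r + 1)" "c (2 * int L - r + 1) = prism_vertex n 1 (i + r)"
          using r im c_high[of "2 * int L - r"] c_high[of "2 * int L - r + 1"] by (simp_all add: algebra_simps)
        ultimately have "e = {c (2 * int L - r), c (2 * int L - r + 1)}"
          using rim(2) V by (simp add: insert_commute)
        then show ?thesis ..
      qed
    next
      case (rung k)
      define r where "r = (k - i) mod int n"
      have r0: "0 \<le> r" "r < int n" using n0 by (simp_all add: r_def)
      have V: "prism_vertex n x k = prism_vertex n x (i + r)" for x
        using n0 by (auto simp: prism_vertex_eq_iff r_def mod_simps)
      have "rung_flow n D f k \<noteq> rung_flow n D g k"
        using ne rung by (simp add: rung_flow_def along_eq_iff)
      then have "((k - 1 - i) mod int n < int L) \<noteq> (r < int L)"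
        using rung_flow_eq(1)[OF n D f, of k] rung_flow_eq(1)[OF n D g, of k] diff[of 0 k] diff[of 0 "k - 1"]
        by (auto simp: r_def split: if_splits)
      moreover have "r = (if (k - 1 - i) mod int n = int n - 1 then 0 else (k - 1 - i) mod int n + 1)"
        using succ_mod[OF n0, of "k - 1" i] by (simp add: r_def)
      ultimately have "r = 0 \<or> r = int L" using r0 L by (auto split: if_splits)
      then show ?thesis
      proof
        assume "r = 0"
        moreover have "c (int m - 1) = prism_vertex n 1 i" "c (int m - 1 + 1) = prism_vertex n 0 i"
          using c_high[of "int m - 1"] c_wrap im L by (simp_all add: add.commute)
        ultimately have "e = {c (int m - 1), c (int m - 1 + 1)}"
          using rung V by (simp add: insert_commute)
        then show ?thesis ..
      next
        assume r: "r = int L"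
        then have "c r = prism_vertex n 0 (i + r)" "c (r + 1) = prism_vertex n 1 (i + r)"
          using c_low[of r] c_high[of "r + 1"] im by (auto simp: add.commute)
        then have "e = {c r, c (r + 1)}" using rung V by simp
        then show ?thesis ..
      qed
    qed
  qed
qed

text \<open>The normal form of a flow: with the inner rim fixed as the negative of the outer one, the outer rim alone
determines the flow, and every colouring occurs as its outer rim.\<close>
definition coloring_flow :: "nat \<Rightarrow> ((nat \<times> nat) \<times> (nat \<times> nat)) set \<Rightarrow> (int \<Rightarrow> 4) \<Rightarrow>
    ((nat \<times> nat) set \<Rightarrow> 4) \<Rightarrow> bool" where
  "coloring_flow n D a f \<longleftrightarrow> flow (prism n) D f \<and>
     rim_flow n D f 0 = a \<and> rim_flow n D f 1 = (\<lambda>k. - a k)"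

lemma coloring_flow_exists:
  assumes n: "3 \<le> n" and D: "orientation (prism n) D" and a: "coloring n a"
  shows "\<exists>f. coloring_flow n D a f"
proof -
  have "a (k - 1) \<noteq> a k" for k using a unfolding coloring_def by (metis diff_add_cancel)
  then have "\<exists>f. flow (prism n) D f \<and> (\<forall>x<2. rim_flow n D f x = (\<lambda>k. if x = 0 then a k else - a k))"
    using a by (intro prism_flow_exists[OF n D]) (auto simp: coloring_def)
  then show ?thesis by (auto simp: coloring_flow_def)
qed

lemma coloring_flow_unique:
  assumes n: "3 \<le> n" and D: "orientation (prism n) D"
    and f: "coloring_flow n D a f" and g: "coloring_flow n D a g"
  shows "f = g"
proof (rule prism_flow_eq_if_rims_eq[OF n D])
  fix x :: nat assume "x < 2"
  then show "rim_flow n D f x = rim_flow n D g x"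
    using f g by (auto simp: coloring_flow_def less_2_cases_iff)
qed (use f g in \<open>simp_all add: coloring_flow_def\<close>)

lemma coloring_steps_flow_equivalent:
  assumes n: "3 \<le> n" and D: "orientation (prism n) D"
    and "(coloring_step n)\<^sup>*\<^sup>* a b" "coloring_flow n D a f" "coloring_flow n D b g"
  shows "flow_equivalent (prism n) D f g"
  using assms(3,5)
proof (induction arbitrary: g rule: rtranclp_induct)
  case base
  then show ?case using coloring_flow_unique[OF n D assms(4)] by (auto simp: flow_equivalent_def)
next
  case (step b c)
  obtain i L x where L: "0 < L" "L < n" and c: "c = shift_segment n i L x b" and b: "coloring n b"
    using step.hyps(2) by (auto simp: coloring_step_def)
  obtain h where h: "coloring_flow n D b h" using coloring_flow_exists[OF n D b] ..
  have "flow_adjacent (prism n) D h g"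
  proof (rule flow_adjacent_along_rectangle[OF n D _ _ L])
    show "rim_flow n D g y k = (if (k - i) mod int n < int L
        then rim_flow n D h y k + (if y = 0 then x else - x) else rim_flow n D h y k)" if "y < 2" for y k
      using that h step.prems by (auto simp: coloring_flow_def less_2_cases_iff c shift_segment_def)
  qed (use h step.prems in \<open>simp_all add: coloring_flow_def\<close>)
  then show ?case using step.IH[OF h] by (simp add: flow_equivalent_def)
qed

text \<open>The outer rim of any flow is a colouring: its values are nonzero, and consecutive ones differ because
the rung between them is nonzero. One change along the inner rim makes that rim its negative.\<close>
lemma flow_equivalent_coloring_flow:
  assumes n: "3 \<le> n" and D: "orientation (prism n) D" and f: "flow (prism n) D f"
  shows "\<exists>a g. coloring n a \<and> coloring_flow n D a g \<and> flow_equivalent (prism n) D f g"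
proof -
  define a where "a = rim_flow n D f 0"
  have "a (k + int n) = a k" for k unfolding a_def by (rule rim_flow_cong) simp
  moreover have "a k \<noteq> 0" for k unfolding a_def by (rule prism_flow_nonzero[OF n f]) simp
  moreover have "a k \<noteq> a (k + 1)" for k
    using prism_flow_nonzero(2)[OF n f, of "k + 1"] rung_flow_eq(1)[OF n D f, of "k + 1"] by (auto simp: a_def)
  ultimately have a: "coloring n a" by (simp add: coloring_def)
  then obtain g where g: "coloring_flow n D a g" using coloring_flow_exists[OF n D] by blast
  have "flow_adjacent (prism n) D f g"
    by (rule flow_adjacent_along_rim[OF n D f, of _ 1]) (use g in \<open>simp_all add: coloring_flow_def a_def\<close>)
  then show ?thesis using a g unfolding flow_equivalent_def by blast
qed

text \<open>For a colouring by \<open>1\<close> and \<open>3\<close> only, adding \<open>2\<close> is the same as negation. So the outer rim can be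
shifted by \<open>2\<close>, and then the inner rim; in the flow between, both rims have equal values.\<close>
lemma flow_equivalent_swapped:
  assumes n: "3 \<le> n" and D: "orientation (prism n) D"
    and a: "coloring n a" "\<And>k. a k \<noteq> 2"
    and f: "coloring_flow n D a f" and g: "coloring_flow n D (\<lambda>k. a k + 2) g"
  shows "flow_equivalent (prism n) D f g"
proof -
  have "a (k - 1) \<noteq> a k" for k using a unfolding coloring_def by (metis diff_add_cancel)
  moreover have eq: "- a k = a k + 2" for k
    using Z4_exhaust[of "a k"] a unfolding coloring_def by auto
  ultimately
  have "\<exists>h. flow (prism n) D h \<and> (\<forall>x<2. rim_flow n D h x = (\<lambda>k. if x = 0 then a k + 2 else - a k))"
    using a by (intro prism_flow_exists[OF n D]) (auto simp: coloring_def Z4_add_two_eq_0_iff)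
  then obtain h where h: "flow (prism n) D h" "rim_flow n D h 0 = (\<lambda>k. a k + 2)" "rim_flow n D h 1 = (\<lambda>k. - a k)"
    by auto
  have fh: "flow_adjacent (prism n) D f h"
    by (rule flow_adjacent_along_rim[OF n D _ h(1), of _ 0]) (use f h in \<open>simp_all add: coloring_flow_def\<close>)
  have hg: "flow_adjacent (prism n) D h g"
    by (rule flow_adjacent_along_rim[OF n D h(1), of _ 1]) (use g h in \<open>simp_all add: coloring_flow_def\<close>)
  show ?thesis
    by (rule flow_equivalent_trans[OF flow_adjacent_imp_equivalent[OF fh] flow_adjacent_imp_equivalent[OF hg]])
qed

text \<open>Both colourings are reduced by single steps. On an even cycle two forms remain, which differ by
\<open>2\<close> everywhere; on an odd cycle all colourings reach the same form.\<close>
lemma coloring_flows_equivalent: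
  assumes n: "4 \<le> n" and D: "orientation (prism n) D"
    and a: "coloring n a" "coloring_flow n D a f" and b: "coloring n b" "coloring_flow n D b g"
  shows "flow_equivalent (prism n) D f g"
proof -
  have n2: "2 \<le> n" and n3: "3 \<le> n" and n0: "0 < n" using n by simp_all
  note steps = coloring_steps_flow_equivalent[OF n3 D]
  have join: ?thesis if "(coloring_step n)\<^sup>*\<^sup>* a a'" "(coloring_step n)\<^sup>*\<^sup>* b b'"
    "coloring_flow n D a' f'" "coloring_flow n D b' g'" "flow_equivalent (prism n) D f' g'" for a' b' f' g'
    using steps[OF that(1) a(2) that(3)] flow_equivalent_sym[OF steps[OF that(2) b(2) that(4)]] that(5)
    unfolding flow_equivalent_def by simp
  obtain a' where a': "(coloring_step n)\<^sup>*\<^sup>* a a'" "coloring n a'"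
    "(\<forall>k. a' k \<noteq> 2) \<or> (\<exists>p. only_two_at n p a' \<and> a' (p - 1) \<noteq> a' (p + 1))"
    using reduce_twos[OF n2 a(1)] by blast
  obtain b' where b': "(coloring_step n)\<^sup>*\<^sup>* b b'" "coloring n b'"
    "(\<forall>k. b' k \<noteq> 2) \<or> (\<exists>p. only_two_at n p b' \<and> b' (p - 1) \<noteq> b' (p + 1))"
    using reduce_twos[OF n2 b(1)] by blast
  show ?thesis
  proof (cases "even n")
    case True
    then have no: "a' k \<noteq> 2" "b' k \<noteq> 2" for k
      using a'(2,3) b'(2,3) coloring_only_two(2)[OF _ n2] by blast+
    have nz: "a' k \<noteq> 0" "b' k \<noteq> 0" for k using a'(2) b'(2) by (auto simp: coloring_def)
    obtain f' g' where f': "coloring_flow n D a' f'" and g': "coloring_flow n D b' g'"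
      using coloring_flow_exists[OF n3 D] a'(2) b'(2) by blast
    note vals = coloring_without_two(2)[OF a'(2) n0 no(1)] coloring_without_two(2)[OF b'(2) n0 no(2)]
    have "flow_equivalent (prism n) D f' g'"
    proof (cases "a' 0 = b' 0")
      case True
      then have "a' k = b' k" for k using vals(1)[of k] vals(2)[of k] by simp
      then have "a' = b'" ..
      then show ?thesis using coloring_flow_unique[OF n3 D f'] g' by (auto simp: flow_equivalent_def)
    next
      case False
      then have "b' 0 = a' 0 + 2" using no nz by (intro Z4_alternate)
      then have "b' k = a' k + 2" for k using vals(1)[of k] vals(2)[of k] by simp
      then have "b' = (\<lambda>k. a' k + 2)" ..
      then show ?thesis using flow_equivalent_swapped[OF n3 D a'(2) no(1) f'] g' by simp
    qed
    then show ?thesis by (rule join[OF a'(1) b'(1) f' g'])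
  next
    case False
    then have n5: "5 \<le> n" using n by (cases "n = 4") auto
    have canonical: "\<exists>d. (coloring_step n)\<^sup>*\<^sup>* c d \<and> coloring n d \<and> only_two_at n 0 d \<and> d 1 = 1"
      if c: "coloring n c" "(\<forall>k. c k \<noteq> 2) \<or> (\<exists>p. only_two_at n p c \<and> c (p - 1) \<noteq> c (p + 1))" for c
      using that coloring_without_two(1)[OF c(1) n0] False normalize_only_two[OF c(1) n5 False] by blast
    obtain a2 where a2: "(coloring_step n)\<^sup>*\<^sup>* a' a2" "coloring n a2" "only_two_at n 0 a2" "a2 1 = 1"
      using canonical[OF a'(2,3)] by blast
    obtain b2 where b2: "(coloring_step n)\<^sup>*\<^sup>* b' b2" "coloring n b2" "only_two_at n 0 b2" "b2 1 = 1"
      using canonical[OF b'(2,3)] by blast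
    have "a2 k = b2 k" for k
      using coloring_only_two(3)[OF a2(2) n2 a2(3), of k] coloring_only_two(3)[OF b2(2) n2 b2(3), of k]
        a2(4) b2(4) by simp
    then have "a2 = b2" ..
    moreover obtain h where "coloring_flow n D a2 h" using coloring_flow_exists[OF n3 D a2(2)] by blast
    moreover have "(coloring_step n)\<^sup>*\<^sup>* a a2" "(coloring_step n)\<^sup>*\<^sup>* b b2"
      using a'(1) a2(1) b'(1) b2(1) by simp_all
    ultimately show ?thesis using join[of a2 b2 h h] by (simp add: flow_equivalent_def)
  qed
qed

theorem theorem3p4:
  fixes n :: nat
  assumes "n \<ge> 4"
  shows "flow_connected TYPE(4) (prism n)"
  unfolding flow_connected_def
proof (intro allI impI)
  fix D and f g :: "(nat \<times> nat) set \<Rightarrow> 4"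
  assume D: "orientation (prism n) D" and f: "flow (prism n) D f" and g: "flow (prism n) D g"
  have n3: "3 \<le> n" using assms by simp
  obtain a f' where a: "coloring n a" "coloring_flow n D a f'" and ff': "flow_equivalent (prism n) D f f'"
    using flow_equivalent_coloring_flow[OF n3 D f] by blast
  obtain b g' where b: "coloring n b" "coloring_flow n D b g'" and gg': "flow_equivalent (prism n) D g g'"
    using flow_equivalent_coloring_flow[OF n3 D g] by blast
  have "flow_equivalent (prism n) D f' g'" by (rule coloring_flows_equivalent[OF assms D a b])
  then show "flow_equivalent (prism n) D f g"
    using ff' flow_equivalent_sym[OF gg'] unfolding flow_equivalent_def by simp
qed

end
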